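(* Let $n$ be a squarefree positive integer such that every prime divisor of $n$ is at least $7$. Suppose $p'$ is a prime divisor of $n$ and $\Omega(n)=3$, and put $n'=n/p'$. Then a sequence in $\mathbb{Z}_n$ is a $D$-extremal sequence for $L(n;p')$ if and only if either it is a $D$-extremal sequence for $U(n)$ or it is a permutation of a sequence $(x_1,x_2,x_3)$ in $\mathbb{Z}_n$ which has one of the following forms: (i) the image of the sequence $(x_1,x_2)$ under $f_{n|n'}$ is a $D$-extremal sequence for $S(n')$, and $x_3$ is a non-zero multiple of $n'$ (in $\mathbb{Z}_n$); (ii) the only term of $(x_1,x_2,x_3)$ which is not divisible by $p'$ is $x_1$, and the image of the sequence $(x_2,x_3)$ under $f_{n|n'}$ is a $D$-extremal sequence for $S(n')$ which is not a $D$-extremal sequence for $U(n')$.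
   Context: For a positive integer $m$, $\mathbb{Z}_m$ denotes the ring $\mathbb{Z}/m\mathbb{Z}$ and $U(m)$ its group of units. For odd $m$ and $x\in U(m)$, $\left(\frac{x}{m}\right)$ denotes the Jacobi symbol, and $S(m)=\{x\in U(m):\left(\frac{x}{m}\right)=1\}$. For a prime divisor $p$ of $n$, $L(n;p)=\{a\in U(n):\left(\frac{a}{n}\right)=\left(\frac{a}{p}\right)\}$. For squarefree $n$, $\Omega(n)$ is the number of prime divisors of $n$. For a divisor $m$ of $n$, $f_{n|m}:\mathbb{Z}_n\to\mathbb{Z}_m$ is the natural map $a+n\mathbb{Z}\mapsto a+m\mathbb{Z}$, applied to sequences term by term. For $A\subseteq\mathbb{Z}_m$, a (nonempty, finite) sequence $(y_1,\ldots,y_k)$ in $\mathbb{Z}_m$ is an $A$-weighted zero-sum sequence if there exist $a_1,\ldots,a_k\in A$ with $a_1y_1+\cdots+a_ky_k=0$. The $A$-weighted Davenport constant $D_A(m)$ is the least positive integer $k$ such that every sequence of length $k$ in $\mathbb{Z}_m$ has a (nonempty) subsequence, not necessarily of consecutive terms, that is an $A$-weighted zero-sum sequence. If $0\notin A$, a $D$-extremal sequence for $A$ is a sequence in $\mathbb{Z}_m$ of length $D_A(m)-1$ which has no $A$-weighted zero-sum subsequence. *)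

theory Defs
  imports "HOL-Number_Theory.Number_Theory" "HOL-Computational_Algebra.Squarefree" "HOL-Library.Sublist"
begin

text \<open>
  The ring of integers modulo \<open>m > 0\<close> is \<^const>\<open>residue_ring\<close>, whose elements are the
  representatives in \<open>{0..m - 1}\<close>. Sequences over it are lists of such representatives.
\<close>

definition Zmod :: "int \<Rightarrow> int set" where
  "Zmod m = carrier (residue_ring m)"

text \<open>
  Only moduli \<open>m > 1\<close> matter: the multiplicative unit of \<open>residue_ring m\<close> is the integer 1,
  which for \<open>m = 1\<close> lies outside the carrier.
\<close>

definition U :: "int \<Rightarrow> int set" where
  "U m = Units (residue_ring m)"

text \<open>
  The prime factors are taken with multiplicity; \<open>m\<close> is meant to be odd and positive.
\<close>

definition Jacobi :: "int \<Rightarrow> int \<Rightarrow> int" where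
  "Jacobi a m = (\<Prod>p\<in>#prime_factorization m. Legendre a p)"

definition S :: "int \<Rightarrow> int set" where
  "S m = {x \<in> U m. Jacobi x m = 1}"

definition L :: "int \<Rightarrow> int \<Rightarrow> int set" where
  "L n p = {a \<in> U n. Jacobi a n = Jacobi a p}"

text \<open>
  The weighted sum is formed in the integers from the representatives; it vanishes in the
  residue ring iff it is congruent to 0.
\<close>

definition weighted_zero_sum :: "int \<Rightarrow> int set \<Rightarrow> int list \<Rightarrow> bool" where
  "weighted_zero_sum m A ys \<longleftrightarrow>
     ys \<noteq> [] \<and>
     (\<exists>cs. length cs = length ys \<and> set cs \<subseteq> A \<and>
        [(\<Sum>i<length ys. cs ! i * ys ! i) = 0] (mod m))"

definition has_weighted_zero_sum_subseq :: "int \<Rightarrow> int set \<Rightarrow> int list \<Rightarrow> bool" where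
  "has_weighted_zero_sum_subseq m A xs \<longleftrightarrow> (\<exists>ys. subseq ys xs \<and> weighted_zero_sum m A ys)"

definition Davenport :: "int \<Rightarrow> int set \<Rightarrow> nat" where
  "Davenport m A =
     (LEAST k. k > 0 \<and>
        (\<forall>xs. set xs \<subseteq> Zmod m \<and> length xs = k \<longrightarrow> has_weighted_zero_sum_subseq m A xs))"

text \<open>Intended for weight sets \<open>A\<close> not containing 0.\<close>

definition D_extremal :: "int \<Rightarrow> int set \<Rightarrow> int list \<Rightarrow> bool" where
  "D_extremal m A xs \<longleftrightarrow>
     set xs \<subseteq> Zmod m \<and> length xs = Davenport m A - 1 \<and>
     \<not> has_weighted_zero_sum_subseq m A xs"

text \<open>
  The natural map from the integers modulo \<open>n\<close> to those modulo \<open>m\<close>, for \<open>m\<close> dividing \<open>n\<close>;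
  on representatives it does not depend on \<open>n\<close>.
\<close>

definition nat_map :: "int \<Rightarrow> int \<Rightarrow> int" where
  "nat_map m x = x mod m"

end

theory Submission
  imports Defs
begin

text \<open>
  Write \<open>n = p q r\<close> with \<open>p = p'\<close>. By the Chinese remainder theorem a weight in \<open>L(n;p)\<close> is an
  arbitrary unit modulo \<open>p\<close> together with units modulo \<open>q\<close> and \<open>r\<close> having the same quadratic
  character. Modulo a prime \<open>l \<ge> 7\<close>, a sequence with prescribed characters of the weights can be
  weighted to zero as soon as it has at least three nonzero terms; with no nonzero term this is
  trivial, with one impossible, and with exactly two, \<open>y\<close> and \<open>y'\<close>, the product of the two
  prescribed characters must be that of \<open>-y y'\<close>. The common characters at \<open>q\<close> and \<open>r\<close> can be
  chosen to suit both primes unless the nonzero terms modulo \<open>q\<close> and modulo \<open>r\<close> are the same two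
  terms and \<open>-y y'\<close> has different characters at \<open>q\<close> and \<open>r\<close>. So everything depends only on
  finitely many possible profiles of the terms (which of \<open>p, q, r\<close> divide it, and whether its
  characters at \<open>q\<close> and \<open>r\<close> agree) and on whether \<open>-1\<close> has the same character at \<open>q\<close> and \<open>r\<close>,
  and the theorem becomes a finite check on sequences of length at most four.
\<close>

section \<open>Sums of elements with prescribed quadratic character\<close>

lemma Legendre_eq_0_iff: "Legendre a p = 0 \<longleftrightarrow> p dvd a"
  by (simp add: Legendre_def cong_0_iff)

lemma Legendre_sign: "\<not> p dvd a \<Longrightarrow> Legendre a p = 1 \<or> Legendre a p = -1"
  by (simp add: Legendre_def cong_0_iff)

lemma Legendre_cong:
  assumes "[a = b] (mod p)"
  shows "Legendre a p = Legendre b p"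
proof -
  have "[x = a] (mod p) \<longleftrightarrow> [x = b] (mod p)" for x
    using assms cong_trans cong_sym by blast
  then have "QuadRes p a \<longleftrightarrow> QuadRes p b" "[a = 0] (mod p) \<longleftrightarrow> [b = 0] (mod p)"
    using assms by (auto simp: QuadRes_def cong_sym_eq[of _ 0])
  then show ?thesis by (simp add: Legendre_def)
qed

text \<open>Euler's criterion gives the identity modulo \<open>p\<close>. Both sides lie in -1, 0,
  1, so they differ by at most 2, and \<open>p > 2\<close> turns the congruence into
  equality.\<close>

lemma Legendre_mult:
  fixes p :: int
  assumes "prime p" "p > 2"
  shows "Legendre (a * b) p = Legendre a p * Legendre b p"
proof -
  define k where "k = nat ((p - 1) div 2)"
  have euler: "[Legendre x p = x ^ k] (mod p)" for x
    using euler_criterion[of "nat p" x] assms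
    by (simp add: k_def nat_div_distrib nat_diff_distrib)
  have "[Legendre a p * Legendre b p = Legendre (a * b) p] (mod p)"
    by (metis (no_types) cong_mult cong_sym cong_trans euler power_mult_distrib)
  then have *: "p dvd Legendre a p * Legendre b p - Legendre (a * b) p"
    by (simp add: cong_iff_dvd_diff)
  have "\<bar>Legendre a p * Legendre b p - Legendre (a * b) p\<bar> \<le> 2"
    by (auto simp: Legendre_def)
  with * assms(2) show ?thesis
    using dvd_imp_le_int[OF _ *] by force
qed

lemma Legendre_square:
  fixes p :: int
  assumes "prime p" "\<not> p dvd x"
  shows "Legendre (x * x) p = 1"
proof -
  have "QuadRes p (x * x)" unfolding QuadRes_def power2_eq_square using cong_refl by blast
  moreover have "\<not> p dvd x * x" using assms by (simp add: prime_dvd_mult_iff)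
  ultimately show ?thesis by (simp add: Legendre_def cong_0_iff)
qed

lemma Legendre_one: "prime (p::int) \<Longrightarrow> Legendre 1 p = 1"
  using Legendre_square[of p 1] prime_gt_1_int[of p] by auto

lemma inverse_mod_prime:
  fixes p :: int
  assumes "prime p" "\<not> p dvd x"
  obtains x' where "[x * x' = 1] (mod p)" "\<not> p dvd x'"
proof -
  have "coprime x p" using assms prime_imp_coprime coprime_commute by blast
  then obtain x' where x': "[x * x' = 1] (mod p)" using cong_solve_coprime_int by blast
  moreover have "\<not> p dvd x'"
  proof
    assume "p dvd x'"
    then have "p dvd x * x'" by simp
    with x' have "p dvd 1" using cong_dvd_iff by blast
    with assms show False by (simp add: not_prime_unit)
  qed
  ultimately show ?thesis using that by blast
qed

text \<open>If every nonzero class were a square, squaring would be onto, hence injective, on the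
  finite set \<open>{1..p-1}\<close>; but \<open>1\<close> and \<open>p - 1\<close> are distinct
  with congruent squares.\<close>

lemma ex_nonresidue:
  fixes p :: int
  assumes "prime p" "p > 2"
  shows "\<exists>a. Legendre a p = -1"
proof (rule ccontr)
  assume neg: "\<nexists>a. Legendre a p = -1"
  define f where "f x = x\<^sup>2 mod p" for x
  have "{1..p-1} \<subseteq> f ` {1..p-1}"
  proof
    fix a assume a: "a \<in> {1..p-1}"
    then have "\<not> p dvd a" using zdvd_not_zless by auto
    then have "Legendre a p = 1" using neg Legendre_sign by blast
    then obtain y where y: "[y\<^sup>2 = a] (mod p)"
      by (auto simp: Legendre_def QuadRes_def split: if_splits)
    have "f (y mod p) = a" using y a unfolding f_def cong_def by (simp add: power_mod)
    moreover have "y mod p \<noteq> 0"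
    proof
      assume "y mod p = 0"
      with \<open>f (y mod p) = a\<close> a show False by (simp add: f_def)
    qed
    moreover have "y mod p \<in> {0..p-1}" using assms by simp
    ultimately show "a \<in> f ` {1..p-1}" by (intro image_eqI[of _ _ "y mod p"]) auto
  qed
  then have "inj_on f {1..p-1}"
    by (metis card_image_le card_mono eq_card_imp_inj_on finite_atLeastAtMost_int finite_imageI le_antisym)
  moreover have "f 1 = f (p - 1)"
  proof -
    have "(p - 1)\<^sup>2 = 1 + p * (p - 2)" by (simp add: power2_eq_square algebra_simps)
    then show ?thesis unfolding f_def by (metis mod_mult_self2 one_power2)
  qed
  ultimately show False using assms by (auto dest!: inj_onD[where x=1 and y="p-1"])
qed

lemma ex_Legendre:
  fixes p :: int
  assumes "prime p" "p > 2" "e = 1 \<or> e = -1"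
  shows "\<exists>a. Legendre a p = e"
  using assms ex_nonresidue Legendre_one by blast

text \<open>Take the least natural nonresidue \<open>s\<close>. By minimality \<open>s - 1\<close>
  is not a nonresidue, and it is nonzero modulo \<open>p\<close> because 1 is a residue.\<close>

lemma ex_consecutive_residue_nonresidue:
  fixes p :: int
  assumes "prime p" "p > 2"
  shows "\<exists>s. Legendre s p = -1 \<and> Legendre (s - 1) p = 1"
proof -
  obtain a where "Legendre a p = -1" using ex_nonresidue assms by blast
  then have ex: "Legendre (int (nat (a mod p))) p = -1"
    using assms Legendre_cong[of "a mod p" a p] by simp
  define s where "s = (LEAST s. Legendre (int s) p = -1)"
  have s: "Legendre (int s) p = -1" unfolding s_def by (rule LeastI[of "\<lambda>s. Legendre (int s) p = -1", OF ex])
  have "s \<noteq> 0" using s Legendre_eq_0_iff[of 0 p] by (intro notI) simp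
  then have "Legendre (int (s - 1)) p \<noteq> -1"
    using not_less_Least[of "s - 1" "\<lambda>s. Legendre (int s) p = -1"] by (simp add: s_def)
  moreover have "\<not> p dvd int s - 1"
  proof
    assume "p dvd int s - 1"
    then have "Legendre (int s) p = Legendre 1 p"
      by (intro Legendre_cong) (simp add: cong_iff_dvd_diff)
    with s show False using assms Legendre_one by simp
  qed
  ultimately show ?thesis using s \<open>s \<noteq> 0\<close> Legendre_sign[of p "int s - 1"]
    by (intro exI[of _ "int s"]) (auto simp: of_nat_diff)
qed

section \<open>Sums of two or more elements of prescribed character\<close>

text \<open>
  The points \<open>(u\<^sup>2 - d, 2u, u\<^sup>2 + d)\<close> lie on the conic; since \<open>(2\<^sup>4 - d\<^sup>2) - (1\<^sup>4 - d\<^sup>2) = 3 \<cdot> 5\<close>, one of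
  \<open>u = 1, 2\<close> makes all coordinates nonzero.
\<close>

lemma conic_point:
  fixes p :: int
  assumes "prime p" "p \<ge> 7" "\<not> p dvd d"
  obtains x y z where "x * x + d * (y * y) = z * z" "\<not> p dvd x" "\<not> p dvd y" "\<not> p dvd z"
proof -
  have small: "\<not> p dvd k" if "0 < k" "k < 7" for k
    by (rule zdvd_not_zless) (use that assms in auto)
  have "\<not> p dvd (3 * 5)" using small[of 3] small[of 5] prime_dvd_multD[OF assms(1), of 3 5] by linarith
  moreover have "(16 - d * d) - (1 - d * d) = 3 * 5" by simp
  ultimately have "\<not> p dvd 16 - d * d \<or> \<not> p dvd 1 - d * d"
    by (metis dvd_diff)
  moreover have "16 - d * d = (2 * 2 - d) * (2 * 2 + d)" "1 - d * d = (1 * 1 - d) * (1 * 1 + d)"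
    by (simp_all add: algebra_simps)
  ultimately obtain u :: int where u: "u = 1 \<or> u = 2" and "\<not> p dvd (u * u - d) * (u * u + d)"
    by metis
  then have nd: "\<not> p dvd u * u - d" "\<not> p dvd u * u + d"
    using dvd_mult dvd_mult2 by blast+
  have "\<not> p dvd 2 * u" using u small[of 2] small[of 4] by auto
  moreover have "(u * u - d) * (u * u - d) + d * ((2 * u) * (2 * u)) = (u * u + d) * (u * u + d)"
    by (simp add: algebra_simps)
  ultimately show ?thesis using nd that by blast
qed

text \<open>If \<open>e\<close> or \<open>f\<close> is the character of \<open>t\<close>, a point of
  the conic x^2 + d y^2 = z^2 with \<open>Legendre d p = e * f\<close>, divided by z^2 and
  multiplied by \<open>t\<close>, splits \<open>t\<close> as required. Otherwise
  \<open>e = f = - Legendre t p\<close>, and consecutive elements \<open>s - 1\<close> and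
  \<open>s\<close> of opposite character are used.\<close>

lemma sum_two_classes:
  fixes p :: int
  assumes p: "prime p" "p \<ge> 7" and t: "\<not> p dvd t"
    and e: "e = 1 \<or> e = -1" and f: "f = 1 \<or> f = -1"
  shows "\<exists>a b. Legendre a p = e \<and> Legendre b p = f \<and> [a + b = t] (mod p)"
proof -
  have p2: "p > 2" using p by simp
  have same: "\<exists>a b. Legendre a p = e \<and> Legendre b p = f \<and> [a + b = t] (mod p)"
    if te: "Legendre t p = e" and e: "e = 1 \<or> e = -1" and f: "f = 1 \<or> f = -1" for e f
  proof -
    obtain d where d: "Legendre d p = e * f"
      using ex_Legendre[OF p(1) p2, of "e * f"] e f by auto
    then have "\<not> p dvd d" using e f Legendre_eq_0_iff[of d p] by auto
    then obtain x y z where xyz: "x * x + d * (y * y) = z * z" "\<not> p dvd x" "\<not> p dvd y" "\<not> p dvd z"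
      using conic_point p by blast
    obtain w where w: "[z * w = 1] (mod p)" "\<not> p dvd w" using inverse_mod_prime p(1) xyz(4) by blast
    let ?a = "t * ((x * w) * (x * w))" and ?b = "t * (d * ((y * w) * (y * w)))"
    have "\<not> p dvd x * w" "\<not> p dvd y * w" using xyz w p(1) by (simp_all add: prime_dvd_mult_iff)
    then have "Legendre ?a p = e" "Legendre ?b p = f"
      using te d e f p(1) p2 by (auto simp: Legendre_mult[OF p(1) p2, of t] Legendre_mult[OF p(1) p2, of d] Legendre_square)
    moreover have "?a + ?b = t * ((z * w) * (z * w))"
    proof -
      have "?a + ?b = t * (w * w) * (x * x + d * (y * y))" by (simp add: algebra_simps)
      then show ?thesis unfolding xyz(1) by (simp add: algebra_simps)
    qed
    moreover have "[t * ((z * w) * (z * w)) = t * (1 * 1)] (mod p)"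
      using w(1) by (intro cong_mult cong_refl)
    ultimately have "Legendre ?a p = e \<and> Legendre ?b p = f \<and> [?a + ?b = t] (mod p)" by simp
    then show ?thesis by blast
  qed
  have ts: "Legendre t p = 1 \<or> Legendre t p = -1" using Legendre_sign t by blast
  consider "Legendre t p = e" | "Legendre t p = f" | "Legendre t p = - e" "e = f"
    using ts e f by auto
  then show ?thesis
  proof cases
    case 1
    then show ?thesis using same e f by blast
  next
    case 2
    then obtain a b where "Legendre a p = f" "Legendre b p = e" "[a + b = t] (mod p)"
      using same f e by blast
    then show ?thesis by (metis add.commute)
  next
    case 3
    \<comment> \<open>Dividing \<open>s = (s - 1) + 1\<close> by \<open>s\<close> and multiplying by
      \<open>t\<close> splits \<open>t\<close>; both summands have the character opposite to that of
      \<open>t\<close>, since 1/s and (s - 1)/s are nonresidues.\<close>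
    obtain s where s: "Legendre s p = -1" "Legendre (s - 1) p = 1"
      using ex_consecutive_residue_nonresidue p(1) p2 by blast
    then have "\<not> p dvd s" using Legendre_eq_0_iff[of s p] by auto
    then obtain w where w: "[s * w = 1] (mod p)" using inverse_mod_prime p(1) by blast
    then have "Legendre s p * Legendre w p = 1"
      using Legendre_cong[OF w] Legendre_one[OF p(1)] by (simp add: Legendre_mult[OF p(1) p2])
    then have "Legendre w p = -1" using s by simp
    then have "Legendre (t * w) p = e" "Legendre (t * w * (s - 1)) p = e"
      using s 3 by (simp_all add: Legendre_mult[OF p(1) p2])
    moreover have "[t * w * (s - 1) + t * w = t] (mod p)"
      using cong_mult[OF cong_refl[of t] w] by (simp add: algebra_simps)
    ultimately show ?thesis using 3 by blast
  qed
qed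

text \<open>Fix all values but two so that their sum is nonzero modulo \<open>p\<close>, then let
  \<open>sum_two_classes\<close> split the negative of that sum into the last two.\<close>

lemma sum_classes_zero:
  fixes p :: int
  assumes p: "prime p" "p \<ge> 7" and N: "finite N" "card N \<ge> 3"
    and e: "\<And>i. i \<in> N \<Longrightarrow> e i = 1 \<or> e i = -1"
  shows "\<exists>b. (\<forall>i\<in>N. Legendre (b i) p = e i) \<and> [(\<Sum>i\<in>N. b i) = 0] (mod p)"
proof -
  have p2: "p > 2" using p by simp
  obtain T where T: "T \<subseteq> N" "card T = 3" using N by (meson obtain_subset_with_card_n)
  then obtain i j k where ijk: "T = {i, j, k}" "i \<noteq> j" "i \<noteq> k" "j \<noteq> k" by (metis card_3_iff)
  define M where "M = N - {i, j, k}"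
  have M: "finite M" "i \<notin> M" "j \<notin> M" "k \<notin> M" "N = insert i (insert j (insert k M))"
    using N T ijk by (auto simp: M_def)
  have "\<forall>l\<in>N. \<exists>a. Legendre a p = e l" using ex_Legendre[OF p(1) p2] e by blast
  then obtain b where b: "\<forall>l\<in>N. Legendre (b l) p = e l" by metis
  define \<sigma> where "\<sigma> = (\<Sum>l\<in>M. b l)"
  have kN: "k \<in> N" using M by simp
  then have nk: "\<not> p dvd b k" using e[OF kN] b Legendre_eq_0_iff[of "b k" p] by auto
  have small: "\<not> p dvd m" if "0 < m" "m < 7" for m
    by (rule zdvd_not_zless) (use that p in auto)
  \<comment> \<open>\<open>b k\<close> and \<open>4 * b k\<close> have the same character and differ
    by \<open>3 * b k\<close>, so at least one of them has a nonzero sum with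
    \<open>\<sigma>\<close>.\<close>
  have "\<not> p dvd 3 * b k" using nk small[of 3] p(1) by (simp add: prime_dvd_mult_iff)
  moreover have "(4 * b k + \<sigma>) - (b k + \<sigma>) = 3 * b k" by simp
  ultimately have "\<not> p dvd 4 * b k + \<sigma> \<or> \<not> p dvd b k + \<sigma>" by (metis dvd_diff)
  moreover have "Legendre (4 * b k) p = Legendre (b k) p"
    using Legendre_square[OF p(1) small[of 2]] by (simp add: Legendre_mult[OF p(1) p2])
  ultimately obtain c where c: "Legendre c p = e k" "\<not> p dvd c + \<sigma>" using b kN by metis
  then have "\<not> p dvd - (c + \<sigma>)" by (simp only: dvd_minus_iff not_False_eq_True)
  then obtain x y where xy: "Legendre x p = e i" "Legendre y p = e j" "[x + y = - (c + \<sigma>)] (mod p)"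
    using sum_two_classes[OF p, of "- (c + \<sigma>)" "e i" "e j"] e M by auto
  define b' where "b' = b(i := x, j := y, k := c)"
  have "(\<Sum>l\<in>M. b' l) = \<sigma>" unfolding \<sigma>_def b'_def using M by (intro sum.cong) auto
  then have "(\<Sum>l\<in>N. b' l) = x + y + (c + \<sigma>)"
    using M(1-4) ijk unfolding M(5) by (simp add: b'_def)
  moreover have "[x + y + (c + \<sigma>) = - (c + \<sigma>) + (c + \<sigma>)] (mod p)"
    using xy(3) by (intro cong_add cong_refl)
  moreover have "\<forall>l\<in>N. Legendre (b' l) p = e l" using b c xy by (simp add: b'_def)
  ultimately show ?thesis by auto
qed

section \<open>Solvability modulo one prime and modulo two linked primes\<close>

text \<open>Terms divisible by \<open>p\<close> drop out, leaving \<open>N\<close>. A single term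
  cannot vanish; for two, the equation c_i y_i = - c_j y_j determines the product of the characters;
  from three on, \<open>sum_classes_zero\<close> applies to the products c_i y_i.\<close>

lemma signed_zero_sum_iff:
  fixes p :: int and y :: "'i \<Rightarrow> int"
  assumes p: "prime p" "p \<ge> 7" and I: "finite I"
    and e: "\<And>i. i \<in> I \<Longrightarrow> e i = 1 \<or> e i = -1"
  defines "N \<equiv> {i \<in> I. \<not> p dvd y i}"
  shows "(\<exists>c. (\<forall>i\<in>I. Legendre (c i) p = e i) \<and> [(\<Sum>i\<in>I. c i * y i) = 0] (mod p)) \<longleftrightarrow>
    card N \<noteq> 1 \<and> (\<forall>i j. N = {i, j} \<longrightarrow> i \<noteq> j \<longrightarrow> e i * e j = Legendre (- (y i * y j)) p)"
    (is "?L \<longleftrightarrow> ?R")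
proof -
  have p2: "p > 2" using p by simp
  note mult = Legendre_mult[OF p(1) p2]
  have N: "finite N" "N \<subseteq> I" using I by (auto simp: N_def)
  have restrict: "[(\<Sum>i\<in>I. c i * y i) = (\<Sum>i\<in>N. c i * y i)] (mod p)" for c
  proof -
    have "(\<Sum>i\<in>I. c i * y i) = (\<Sum>i\<in>N. c i * y i) + (\<Sum>i\<in>I-N. c i * y i)"
      using sum.subset_diff[OF N(2) I, of "\<lambda>i. c i * y i"] by simp
    moreover have "p dvd (\<Sum>i\<in>I-N. c i * y i)" by (rule dvd_sum) (auto simp: N_def)
    ultimately show ?thesis by (simp add: cong_iff_dvd_diff)
  qed
  have y_sign: "Legendre (y i) p = 1 \<or> Legendre (y i) p = -1" if "i \<in> N" for i
    using that Legendre_sign by (auto simp: N_def)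
  have "\<forall>i\<in>I. \<exists>a. Legendre a p = e i" using ex_Legendre[OF p(1) p2] e by blast
  then obtain s where s: "\<forall>i\<in>I. Legendre (s i) p = e i" by metis
  show ?thesis
  proof
    assume ?L
    then obtain c where c: "\<forall>i\<in>I. Legendre (c i) p = e i" "[(\<Sum>i\<in>I. c i * y i) = 0] (mod p)" by blast
    have sum0: "[(\<Sum>i\<in>N. c i * y i) = 0] (mod p)" using c(2) restrict cong_trans cong_sym by blast
    have "card N \<noteq> 1"
    proof
      assume "card N = 1"
      then obtain i where i: "N = {i}" by (auto simp: card_1_singleton_iff)
      then have "p dvd c i * y i" using sum0 by (simp add: cong_0_iff)
      moreover have "\<not> p dvd y i" "i \<in> I" using i by (auto simp: N_def)
      ultimately have "Legendre (c i) p = 0" using p(1) by (simp add: prime_dvd_mult_iff Legendre_eq_0_iff)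
      then show False using c(1) e[OF \<open>i \<in> I\<close>] \<open>i \<in> I\<close> by auto
    qed
    moreover have "e i * e j = Legendre (- (y i * y j)) p" if ij: "N = {i, j}" "i \<noteq> j" for i j
    proof -
      have "[c i * y i + c j * y j = 0] (mod p)" using sum0 ij by simp
      then have "[c i * y i = - 1 * (c j * y j)] (mod p)" by (simp add: cong_iff_dvd_diff)
      from Legendre_cong[OF this]
      have "Legendre (c i) p * Legendre (y i) p = Legendre (-1) p * (Legendre (c j) p * Legendre (y j) p)"
        unfolding mult .
      then have eq: "e i * Legendre (y i) p = Legendre (-1) p * (e j * Legendre (y j) p)"
        using c(1) N(2) ij by simp
      have "Legendre (- (y i * y j)) p = Legendre (-1) p * (Legendre (y i) p * Legendre (y j) p)"
        by (metis mult mult_minus1)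
      then show ?thesis using eq y_sign[of i] y_sign[of j] e[of i] e[of j] ij N(2) by auto
    qed
    ultimately show ?R by blast
  next
    assume R: ?R
    consider "card N = 0" | "card N = 2" | "card N \<ge> 3" using R by linarith
    then have "\<exists>c. (\<forall>i\<in>N. Legendre (c i) p = e i) \<and> [(\<Sum>i\<in>N. c i * y i) = 0] (mod p)"
    proof cases
      case 1
      then show ?thesis using N by simp
    next
      case 2
      then obtain i j where ij: "N = {i, j}" "i \<noteq> j" by (meson card_2_iff)
      have eij: "e i * e j = Legendre (- (y i * y j)) p" using R ij by blast
      have yi: "Legendre (y i) p = 1 \<or> Legendre (y i) p = -1" and ej: "e j = 1 \<or> e j = -1"
        and ei: "e i = 1 \<or> e i = -1"
        using y_sign[of i] e[of i] e[of j] ij N(2) by auto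
      \<comment> \<open>The weights will be \<open>- y j * w\<close> and \<open>y i * w\<close>,
        whose weighted sum cancels. The character of \<open>w\<close> is chosen to suit the second;
        the hypothesis on \<open>e i * e j\<close> then gives the first.\<close>
      then have "e j * Legendre (y i) p = 1 \<or> e j * Legendre (y i) p = -1" by auto
      then obtain w where w: "Legendre w p = e j * Legendre (y i) p"
        using ex_Legendre[OF p(1) p2] by blast
      have "Legendre (- y j * w) p = e j * Legendre (- y j * y i) p"
        unfolding mult w by simp
      moreover have "- y j * y i = - (y i * y j)" by simp
      ultimately have "Legendre (- y j * w) p = e j * (e i * e j)" by (simp only: eij)
      then have "Legendre (- y j * w) p = e i" using ej by auto
      moreover have "Legendre (y i * w) p = e j" using w yi ej by (auto simp: mult)
      ultimately show ?thesis using ij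
        by (intro exI[of _ "\<lambda>k. if k = i then - y j * w else y i * w"]) auto
    next
      case 3
      \<comment> \<open>The values \<open>b i\<close> stand for weight times term, hence their
        character; the weight is recovered by dividing by \<open>y i\<close>.\<close>
      have "e i * Legendre (y i) p = 1 \<or> e i * Legendre (y i) p = -1" if "i \<in> N" for i
        using y_sign[OF that] e[of i] that N(2) by auto
      then obtain b where b: "\<forall>i\<in>N. Legendre (b i) p = e i * Legendre (y i) p"
          "[(\<Sum>i\<in>N. b i) = 0] (mod p)"
        using sum_classes_zero[OF p N(1) 3, of "\<lambda>i. e i * Legendre (y i) p"] by blast
      have "\<exists>v. [y i * v = 1] (mod p)" if "i \<in> N" for i
        using inverse_mod_prime[OF p(1), of "y i"] that unfolding N_def by blast
      then obtain v where v: "\<forall>i\<in>N. [y i * v i = 1] (mod p)" by metis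
      have "Legendre (b i * v i) p = e i" if i: "i \<in> N" for i
      proof -
        have "Legendre (y i) p * Legendre (v i) p = 1"
          using Legendre_cong[of "y i * v i" 1 p] v i Legendre_one[OF p(1)] by (simp add: mult)
        then show ?thesis using b(1) i by (simp add: mult)
      qed
      moreover have "[(\<Sum>i\<in>N. b i * v i * y i) = (\<Sum>i\<in>N. b i)] (mod p)"
      proof (rule cong_sum)
        fix i assume "i \<in> N"
        then show "[b i * v i * y i = b i] (mod p)"
          using cong_mult[OF cong_refl[of "b i"], of "y i * v i" 1 p] v by (simp add: ac_simps)
      qed
      ultimately show ?thesis using cong_trans[OF _ b(2)]
        by (intro exI[of _ "\<lambda>i. b i * v i"]) simp
    qed
    then obtain c where c: "\<forall>i\<in>N. Legendre (c i) p = e i" "[(\<Sum>i\<in>N. c i * y i) = 0] (mod p)" by blast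
    define c' where "c' i = (if i \<in> N then c i else s i)" for i
    have "(\<Sum>i\<in>N. c' i * y i) = (\<Sum>i\<in>N. c i * y i)" by (rule sum.cong) (auto simp: c'_def)
    then have "[(\<Sum>i\<in>I. c' i * y i) = 0] (mod p)" using restrict[of c'] c(2) cong_trans by simp
    moreover have "\<forall>i\<in>I. Legendre (c' i) p = e i" using c(1) s by (simp add: c'_def)
    ultimately show ?L by blast
  qed
qed

text \<open>Each of \<open>M\<close> and \<open>N\<close> constrains the signs only if it is a pair,
  and then only the product of two of them. Two such constraints can conflict only when the pairs
  coincide, which is where \<open>agree\<close> enters.\<close>

lemma ex_signs_two_primes:
  assumes "finite M" "finite N" "card M \<noteq> 1" "card N \<noteq> 1"
    and f: "\<And>i j. f i j = f j i" "\<And>i j. f i j = 1 \<or> f i j = (-1::int)"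
    and g: "\<And>i j. g i j = g j i" "\<And>i j. g i j = 1 \<or> g i j = (-1::int)"
    and agree: "\<And>i j. M = {i, j} \<Longrightarrow> N = {i, j} \<Longrightarrow> i \<noteq> j \<Longrightarrow> f i j = g i j"
  shows "\<exists>e. (\<forall>i. e i = 1 \<or> e i = -1) \<and>
    (\<forall>i j. M = {i, j} \<longrightarrow> i \<noteq> j \<longrightarrow> e i * e j = f i j) \<and>
    (\<forall>i j. N = {i, j} \<longrightarrow> i \<noteq> j \<longrightarrow> e i * e j = g i j)"
proof -
  consider (M) "card M \<noteq> 2" | (N) "card N \<noteq> 2" | (eq) "card M = 2" "M = N"
    | (ne) "card M = 2" "card N = 2" "M \<noteq> N" by blast
  then show ?thesis
  proof cases
    case M
    show ?thesis
    proof (cases "card N = 2")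
      case True
      then obtain i j where ij: "N = {i, j}" "i \<noteq> j" by (meson card_2_iff)
      have "M \<noteq> {k, l}" if "k \<noteq> l" for k l using M that by auto
      then show ?thesis using ij f g
        by (intro exI[of _ "(\<lambda>_. 1)(i := g i j)"]) (auto simp: doubleton_eq_iff)
    next
      case False
      with M have "M \<noteq> {k, l}" "N \<noteq> {k, l}" if "k \<noteq> l" for k l using that by auto
      then show ?thesis by (intro exI[of _ "\<lambda>_. 1"]) auto
    qed
  next
    case N
    show ?thesis
    proof (cases "card M = 2")
      case True
      then obtain i j where ij: "M = {i, j}" "i \<noteq> j" by (meson card_2_iff)
      have "N \<noteq> {k, l}" if "k \<noteq> l" for k l using N that by auto
      then show ?thesis using ij f g
        by (intro exI[of _ "(\<lambda>_. 1)(i := f i j)"]) (auto simp: doubleton_eq_iff)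
    next
      case False
      with N have "M \<noteq> {k, l}" "N \<noteq> {k, l}" if "k \<noteq> l" for k l using that by auto
      then show ?thesis by (intro exI[of _ "\<lambda>_. 1"]) auto
    qed
  next
    case eq
    then obtain i j where ij: "M = {i, j}" "i \<noteq> j" by (meson card_2_iff)
    with eq have "f i j = g i j" using agree by blast
    then show ?thesis using ij eq f g
      by (intro exI[of _ "(\<lambda>_. 1)(i := f i j)"]) (auto simp: doubleton_eq_iff)
  next
    case ne
    \<comment> \<open>Distinct pairs each have a private element: the sign at \<open>i\<close>
      affects only the condition of \<open>M\<close>, the one at \<open>k\<close> only that of
      \<open>N\<close>; all other signs are 1.\<close>
    have "\<not> M \<subseteq> N" "\<not> N \<subseteq> M"
      using ne assms(1,2) card_subset_eq by metis+
    then obtain i k where ik: "i \<in> M" "i \<notin> N" "k \<in> N" "k \<notin> M" by blast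
    obtain j where j: "M = {i, j}" "i \<noteq> j" using ik ne(1) by (fastforce simp: card_2_iff)
    obtain l where l: "N = {k, l}" "k \<noteq> l" using ik ne(2) by (fastforce simp: card_2_iff)
    show ?thesis using ik j l f g
      by (intro exI[of _ "(\<lambda>_. 1)(i := f i j, k := g k l)"]) (auto simp: doubleton_eq_iff)
  qed
qed

text \<open>Free units amount to a free choice of characters, and for a pair some choice has the
  required product. \<open>ex_signs_two_primes\<close> supplies it, with both sets and both
  functions taken equal.\<close>

lemma unit_zero_sum_iff:
  fixes p :: int and y :: "'i \<Rightarrow> int"
  assumes p: "prime p" "p \<ge> 7" and I: "finite I"
  defines "N \<equiv> {i \<in> I. \<not> p dvd y i}"
  shows "(\<exists>c. (\<forall>i\<in>I. \<not> p dvd c i) \<and> [(\<Sum>i\<in>I. c i * y i) = 0] (mod p)) \<longleftrightarrow> card N \<noteq> 1"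
proof
  assume "\<exists>c. (\<forall>i\<in>I. \<not> p dvd c i) \<and> [(\<Sum>i\<in>I. c i * y i) = 0] (mod p)"
  then obtain c where c: "\<forall>i\<in>I. \<not> p dvd c i" "[(\<Sum>i\<in>I. c i * y i) = 0] (mod p)" by blast
  with signed_zero_sum_iff[OF p I, of "\<lambda>i. Legendre (c i) p" y] Legendre_sign
  show "card N \<noteq> 1" unfolding N_def by blast
next
  assume "card N \<noteq> 1"
  \<comment> \<open>The value -1 also stands in where the symbol is 0, so that \<open>f\<close> is a
    sign everywhere; on pairs from \<open>N\<close> it is the Legendre symbol.\<close>
  define f where "f i j = (if Legendre (- (y i * y j)) p = 1 then 1 else -1 :: int)" for i j
  have f_sym: "f i j = f j i" and f_sign: "f i j = 1 \<or> f i j = -1" for i j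
    by (simp_all add: f_def mult.commute)
  have "finite N" using I by (simp add: N_def)
  then obtain e where e: "\<forall>i. e i = 1 \<or> e i = -1"
      "\<forall>i j. N = {i, j} \<longrightarrow> i \<noteq> j \<longrightarrow> e i * e j = f i j"
    using ex_signs_two_primes[OF _ _ \<open>card N \<noteq> 1\<close> \<open>card N \<noteq> 1\<close>, of f f] f_sym f_sign by blast
  have "e i * e j = Legendre (- (y i * y j)) p" if "N = {i, j}" "i \<noteq> j" for i j
  proof -
    have "\<not> p dvd - (y i * y j)" using that p(1) by (auto simp: N_def prime_dvd_mult_iff)
    from Legendre_sign[OF this] have "f i j = Legendre (- (y i * y j)) p" by (auto simp: f_def)
    then show ?thesis using e(2) that by simp
  qed
  then obtain c where c: "\<forall>i\<in>I. Legendre (c i) p = e i" "[(\<Sum>i\<in>I. c i * y i) = 0] (mod p)"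
    using signed_zero_sum_iff[OF p I, of e y] e(1) \<open>card N \<noteq> 1\<close> unfolding N_def by blast
  then have "\<forall>i\<in>I. \<not> p dvd c i" using e(1) Legendre_eq_0_iff by (metis zero_neq_neg_one zero_neq_one)
  with c show "\<exists>c. (\<forall>i\<in>I. \<not> p dvd c i) \<and> [(\<Sum>i\<in>I. c i * y i) = 0] (mod p)" by blast
qed

text \<open>The common characters of the weights form one sign function \<open>e\<close>, to which
  \<open>signed_zero_sum_iff\<close> applies at both primes. Conversely
  \<open>ex_signs_two_primes\<close> provides such an \<open>e\<close>, and the weights modulo
  \<open>q\<close> and \<open>r\<close> are then found separately.\<close>

lemma linked_zero_sum_iff:
  fixes q r :: int and y :: "'i \<Rightarrow> int"
  assumes q: "prime q" "q \<ge> 7" and r: "prime r" "r \<ge> 7" and I: "finite I"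
  defines "M \<equiv> {i \<in> I. \<not> q dvd y i}" and "N \<equiv> {i \<in> I. \<not> r dvd y i}"
  shows "(\<exists>c d. (\<forall>i\<in>I. \<not> q dvd c i \<and> \<not> r dvd d i \<and> Legendre (c i) q = Legendre (d i) r) \<and>
      [(\<Sum>i\<in>I. c i * y i) = 0] (mod q) \<and> [(\<Sum>i\<in>I. d i * y i) = 0] (mod r)) \<longleftrightarrow>
    card M \<noteq> 1 \<and> card N \<noteq> 1 \<and>
    (\<forall>i j. M = {i, j} \<longrightarrow> N = {i, j} \<longrightarrow> i \<noteq> j \<longrightarrow>
       Legendre (- (y i * y j)) q = Legendre (- (y i * y j)) r)"
    (is "?L \<longleftrightarrow> ?R")
proof
  assume ?L
  then obtain c d where cd: "\<forall>i\<in>I. \<not> q dvd c i \<and> \<not> r dvd d i \<and> Legendre (c i) q = Legendre (d i) r"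
      "[(\<Sum>i\<in>I. c i * y i) = 0] (mod q)" "[(\<Sum>i\<in>I. d i * y i) = 0] (mod r)" by blast
  define e where "e i = Legendre (c i) q" for i
  have e: "e i = 1 \<or> e i = -1" if "i \<in> I" for i
    using cd(1) that Legendre_sign[of q "c i"] by (auto simp: e_def)
  have "card M \<noteq> 1 \<and> (\<forall>i j. M = {i, j} \<longrightarrow> i \<noteq> j \<longrightarrow> e i * e j = Legendre (- (y i * y j)) q)"
    unfolding M_def
  proof (rule signed_zero_sum_iff[OF q I e, THEN iffD1])
    show "\<exists>c. (\<forall>i\<in>I. Legendre (c i) q = e i) \<and> [(\<Sum>i\<in>I. c i * y i) = 0] (mod q)"
      using cd(2) by (intro exI[of _ c]) (simp add: e_def)
  qed
  moreover have "card N \<noteq> 1 \<and> (\<forall>i j. N = {i, j} \<longrightarrow> i \<noteq> j \<longrightarrow> e i * e j = Legendre (- (y i * y j)) r)"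
    unfolding N_def
  proof (rule signed_zero_sum_iff[OF r I e, THEN iffD1])
    show "\<exists>c. (\<forall>i\<in>I. Legendre (c i) r = e i) \<and> [(\<Sum>i\<in>I. c i * y i) = 0] (mod r)"
      using cd(1,3) by (intro exI[of _ d]) (simp add: e_def)
  qed
  ultimately show ?R by metis
next
  assume R: ?R
  define f where "f l i j = (if Legendre (- (y i * y j)) l = 1 then 1 else -1 :: int)" for l i j
  have f: "f l i j = Legendre (- (y i * y j)) l" if "prime l" "\<not> l dvd y i" "\<not> l dvd y j" for l i j
  proof -
    have "\<not> l dvd - (y i * y j)" using that by (auto simp: prime_dvd_mult_iff)
    from Legendre_sign[OF this] show ?thesis by (auto simp: f_def)
  qed
  have fM: "f q i j = Legendre (- (y i * y j)) q" if "M = {i, j}" for i j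
    by (rule f) (use that q in \<open>auto simp: M_def\<close>)
  have fN: "f r i j = Legendre (- (y i * y j)) r" if "N = {i, j}" for i j
    by (rule f) (use that r in \<open>auto simp: N_def\<close>)
  have fin: "finite M" "finite N" using I by (simp_all add: M_def N_def)
  have agree: "f q i j = f r i j" if "M = {i, j}" "N = {i, j}" "i \<noteq> j" for i j
    using R that fM fN by simp
  have f_sym: "f l i j = f l j i" and f_sign: "f l i j = 1 \<or> f l i j = -1" for l i j
    by (simp_all add: f_def mult.commute)
  have "\<exists>e. (\<forall>i. e i = 1 \<or> e i = -1) \<and>
      (\<forall>i j. M = {i, j} \<longrightarrow> i \<noteq> j \<longrightarrow> e i * e j = f q i j) \<and>
      (\<forall>i j. N = {i, j} \<longrightarrow> i \<noteq> j \<longrightarrow> e i * e j = f r i j)"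
    by (rule ex_signs_two_primes[OF fin]) (use R f_sign agree in \<open>auto intro: f_sym\<close>)
  then obtain e where e: "\<forall>i. e i = 1 \<or> e i = -1"
      "\<forall>i j. M = {i, j} \<longrightarrow> i \<noteq> j \<longrightarrow> e i * e j = f q i j"
      "\<forall>i j. N = {i, j} \<longrightarrow> i \<noteq> j \<longrightarrow> e i * e j = f r i j"
    by blast
  have "card M \<noteq> 1 \<and> (\<forall>i j. M = {i, j} \<longrightarrow> i \<noteq> j \<longrightarrow> e i * e j = Legendre (- (y i * y j)) q)"
    using R e(2) fM by simp
  then have "\<exists>c. (\<forall>i\<in>I. Legendre (c i) q = e i) \<and> [(\<Sum>i\<in>I. c i * y i) = 0] (mod q)"
    unfolding M_def using e(1) by (intro signed_zero_sum_iff[OF q I, THEN iffD2]) auto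
  then obtain c where c: "\<forall>i\<in>I. Legendre (c i) q = e i" "[(\<Sum>i\<in>I. c i * y i) = 0] (mod q)" by blast
  have "card N \<noteq> 1 \<and> (\<forall>i j. N = {i, j} \<longrightarrow> i \<noteq> j \<longrightarrow> e i * e j = Legendre (- (y i * y j)) r)"
    using R e(3) fN by simp
  then have "\<exists>d. (\<forall>i\<in>I. Legendre (d i) r = e i) \<and> [(\<Sum>i\<in>I. d i * y i) = 0] (mod r)"
    unfolding N_def using e(1) by (intro signed_zero_sum_iff[OF r I, THEN iffD2]) auto
  then obtain d where d: "\<forall>i\<in>I. Legendre (d i) r = e i" "[(\<Sum>i\<in>I. d i * y i) = 0] (mod r)" by blast
  have "\<forall>i\<in>I. \<not> q dvd c i \<and> \<not> r dvd d i \<and> Legendre (c i) q = Legendre (d i) r"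
    using c d e(1) Legendre_eq_0_iff by (metis zero_neq_neg_one zero_neq_one)
  with c d show ?L by blast
qed

section \<open>Weighted zero-sum sequences modulo a product of distinct primes\<close>

text \<open>With \<open>Q\<close> selecting the terms not divisible by a prime, this is the
  criterion of \<open>unit_zero_sum_iff\<close>.\<close>

definition balanced :: "('a \<Rightarrow> bool) \<Rightarrow> 'a list \<Rightarrow> bool" where
  "balanced Q ys \<longleftrightarrow> length (filter Q ys) \<noteq> 1"

text \<open>
  The only obstruction to choosing the common characters at \<open>q\<close> and \<open>r\<close>: \<open>Q\<close> and \<open>R\<close> select the
  terms not divisible by \<open>q\<close> and \<open>r\<close>, \<open>s\<close> holds for terms with equal characters, and \<open>c\<close> says
  that \<open>-1\<close> has equal characters.
\<close>

definition clash :: "bool \<Rightarrow> ('a \<Rightarrow> bool) \<Rightarrow> ('a \<Rightarrow> bool) \<Rightarrow> ('a \<Rightarrow> bool) \<Rightarrow> 'a list \<Rightarrow> bool" where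
  "clash c Q R s ys \<longleftrightarrow> map Q ys = map R ys \<and>
     (case filter Q ys of [x, y] \<Rightarrow> (s x = s y) \<noteq> c | _ \<Rightarrow> False)"

lemma filter_eq_pair:
  fixes Q :: "'a \<Rightarrow> bool"
  assumes "{i. i < length ys \<and> Q (ys ! i)} = {i, j}" "i < j"
  shows "filter Q ys = [ys ! i, ys ! j]"
proof -
  have "filter (\<lambda>i. Q (ys ! i)) [0..<length ys] = [i, j]"
  proof (rule sorted_distinct_set_unique)
    show "set (filter (\<lambda>i. Q (ys ! i)) [0..<length ys]) = set [i, j]" using assms(1) by auto
  qed (use assms(2) in \<open>simp_all add: sorted_wrt_filter\<close>)
  moreover have "filter Q ys = map ((!) ys) (filter (\<lambda>i. Q (ys ! i)) [0..<length ys])"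
    using filter_map[of Q "(!) ys" "[0..<length ys]"] by (simp add: map_nth comp_def)
  ultimately show ?thesis by simp
qed

text \<open>Passes from pairs of indices, as in \<open>linked_zero_sum_iff\<close>, to the list form
  that can be evaluated on profiles. Symmetry of \<open>P\<close> makes the order of the pair
  immaterial.\<close>

lemma clash_iff_nth:
  assumes s: "\<And>i j. P i j = P j i"
    and P: "\<And>i j. i < length ys \<Longrightarrow> j < length ys \<Longrightarrow> Q (ys ! i) \<Longrightarrow> Q (ys ! j) \<Longrightarrow> R (ys ! i) \<Longrightarrow> R (ys ! j) \<Longrightarrow>
      P i j \<longleftrightarrow> (s (ys ! i) = s (ys ! j)) = c"
  shows "clash c Q R s ys \<longleftrightarrow>
    \<not> (\<forall>i j. {i \<in> {..<length ys}. Q (ys ! i)} = {i, j} \<longrightarrow> {i \<in> {..<length ys}. R (ys ! i)} = {i, j} \<longrightarrow> i \<noteq> j \<longrightarrow> P i j)"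
    (is "_ \<longleftrightarrow> \<not> ?all")
proof -
  define M where "M = {i. i < length ys \<and> Q (ys ! i)}"
  define N where "N = {i. i < length ys \<and> R (ys ! i)}"
  have eq: "map Q ys = map R ys \<longleftrightarrow> M = N"
    by (auto simp: list_eq_iff_nth_eq M_def N_def)
  have len: "length (filter Q ys) = card M" unfolding M_def by (rule length_filter_conv_card)
  have all: "?all \<longleftrightarrow> (\<forall>i j. M = {i, j} \<longrightarrow> N = {i, j} \<longrightarrow> i \<noteq> j \<longrightarrow> P i j)"
    by (simp add: M_def N_def)
  show ?thesis
  proof (cases "M = N \<and> card M = 2")
    case True
    then obtain i j where ij: "M = {i, j}" "i \<noteq> j" by (meson card_2_iff)
    obtain k l where kl: "M = {k, l}" "k < l"
      using that ij by (metis insert_commute nat_neq_iff)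
    then have F: "filter Q ys = [ys ! k, ys ! l]" unfolding M_def by (rule filter_eq_pair)
    have "k \<in> M" "l \<in> M" "k \<in> N" "l \<in> N" using kl True by auto
    then have Pkl: "P k l \<longleftrightarrow> (s (ys ! k) = s (ys ! l)) = c" by (intro P) (auto simp: M_def N_def)
    have "?all \<longleftrightarrow> P k l"
      unfolding all using True kl s[of k l] by (auto simp: doubleton_eq_iff)
    moreover have "clash c Q R s ys \<longleftrightarrow> \<not> P k l"
      unfolding clash_def eq F Pkl using True by simp
    ultimately show ?thesis by (simp only:)
  next
    case False
    have "\<not> clash c Q R s ys"
    proof
      assume C: "clash c Q R s ys"
      then have "M = N" unfolding clash_def eq by blast
      moreover have "length (filter Q ys) = 2"
        using C unfolding clash_def by (auto split: list.splits)
      ultimately show False using False len by simp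
    qed
    moreover have ?all unfolding all using False by auto
    ultimately show ?thesis by blast
  qed
qed

section \<open>Chinese remainder theorem: gluing weights chosen modulo each prime\<close>

lemma chinese_remainder_primes:
  fixes P :: "int set"
  assumes "finite P" "\<And>l. l \<in> P \<Longrightarrow> prime l"
  shows "\<exists>x. \<forall>l\<in>P. [x = u l] (mod l)"
  using assms
proof (induction P rule: finite_induct)
  case (insert l P)
  then obtain x where x: "\<forall>k\<in>P. [x = u k] (mod k)" by auto
  have "coprime l (\<Prod>P)"
    by (rule prod_coprime_right) (use insert in \<open>metis insertI1 insertI2 primes_coprime\<close>)
  then obtain z where z: "[z = u l] (mod l)" "[z = x] (mod \<Prod>P)"
    using binary_chinese_remainder_int by blast
  have "[z = u k] (mod k)" if "k \<in> P" for k
  proof -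
    have "k dvd \<Prod>P" using insert(1) that by (simp add: dvd_prod_eqI)
    then have "[z = x] (mod k)" by (rule cong_dvd_modulus[OF z(2)])
    then show ?thesis using x that cong_trans by blast
  qed
  with z show ?case by blast
qed simp

lemma prod_primes_dvd_iff:
  fixes P :: "int set"
  assumes "finite P" "\<And>l. l \<in> P \<Longrightarrow> prime l"
  shows "\<Prod>P dvd x \<longleftrightarrow> (\<forall>l\<in>P. l dvd x)"
  using assms
proof (induction P rule: finite_induct)
  case (insert l P)
  have "coprime l (\<Prod>P)"
    by (rule prod_coprime_right) (use insert in \<open>metis insertI1 insertI2 primes_coprime\<close>)
  then have "l * \<Prod>P dvd x \<longleftrightarrow> l dvd x \<and> \<Prod>P dvd x"
    by (meson divides_mult dvd_mult_left dvd_mult_right)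
  then show ?case using insert by simp
qed simp

lemma weighted_zero_sum_iff_fun:
  "weighted_zero_sum m A ys \<longleftrightarrow> ys \<noteq> [] \<and>
     (\<exists>c. (\<forall>i<length ys. c i \<in> A) \<and> [(\<Sum>i<length ys. c i * ys ! i) = 0] (mod m))"
proof -
  have "(\<exists>cs. length cs = length ys \<and> set cs \<subseteq> A \<and> [(\<Sum>i<length ys. cs ! i * ys ! i) = 0] (mod m)) \<longleftrightarrow>
     (\<exists>c. (\<forall>i<length ys. c i \<in> A) \<and> [(\<Sum>i<length ys. c i * ys ! i) = 0] (mod m))" (is "?L = ?R")
  proof
    assume ?L
    then obtain cs where "length cs = length ys" "set cs \<subseteq> A" "[(\<Sum>i<length ys. cs ! i * ys ! i) = 0] (mod m)" by blast
    then show ?R by (intro exI[of _ "(!) cs"]) auto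
  next
    assume ?R
    then obtain c where "\<forall>i<length ys. c i \<in> A" "[(\<Sum>i<length ys. c i * ys ! i) = 0] (mod m)" by blast
    then show ?L by (intro exI[of _ "map c [0..<length ys]"]) auto
  qed
  then show ?thesis by (simp add: weighted_zero_sum_def)
qed

text \<open>\<open>W\<close> is a condition on the family of residues of a weight at the primes of
  \<open>P\<close>, and by assumption only these residues matter. So weights may be chosen modulo
  each prime, tied together by \<open>W\<close> alone, and glued by the Chinese remainder
  theorem.\<close>

lemma weighted_zero_sum_iff_local:
  assumes P: "finite P" "\<And>l. l \<in> P \<Longrightarrow> prime l"
    and A: "\<And>a. a \<in> A \<longleftrightarrow> 0 \<le> a \<and> a < \<Prod>P \<and> W (\<lambda>_. a)"
    and W: "\<And>f g. (\<And>l. l \<in> P \<Longrightarrow> [f l = g l] (mod l)) \<Longrightarrow> W f \<Longrightarrow> W g"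
  shows "weighted_zero_sum (\<Prod>P) A ys \<longleftrightarrow> ys \<noteq> [] \<and>
    (\<exists>d. (\<forall>i<length ys. W (\<lambda>l. d l i)) \<and> (\<forall>l\<in>P. [(\<Sum>i<length ys. d l i * ys ! i) = 0] (mod l)))"
proof -
  have pos: "\<Prod>P > 0" by (rule prod_pos) (use P prime_gt_0_int in auto)
  have zero: "[x = 0] (mod \<Prod>P) \<longleftrightarrow> (\<forall>l\<in>P. [x = 0] (mod l))" for x
    using prod_primes_dvd_iff[OF P] by (simp add: cong_0_iff)
  have "(\<exists>c. (\<forall>i<length ys. c i \<in> A) \<and> [(\<Sum>i<length ys. c i * ys ! i) = 0] (mod \<Prod>P)) \<longleftrightarrow>
    (\<exists>d. (\<forall>i<length ys. W (\<lambda>l. d l i)) \<and> (\<forall>l\<in>P. [(\<Sum>i<length ys. d l i * ys ! i) = 0] (mod l)))"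
    (is "?L = ?R")
  proof
    assume ?L
    then obtain c where "\<forall>i<length ys. c i \<in> A" "[(\<Sum>i<length ys. c i * ys ! i) = 0] (mod \<Prod>P)" by blast
    then show ?R unfolding zero A by (intro exI[of _ "\<lambda>_. c"]) simp
  next
    assume ?R
    then obtain d where d: "\<forall>i<length ys. W (\<lambda>l. d l i)"
        "\<forall>l\<in>P. [(\<Sum>i<length ys. d l i * ys ! i) = 0] (mod l)" by blast
    have "\<exists>x. \<forall>l\<in>P. [x = d l i] (mod l)" for i by (rule chinese_remainder_primes[OF P])
    then obtain x where x: "\<And>i. \<forall>l\<in>P. [x i = d l i] (mod l)" by metis
    define c where "c i = x i mod \<Prod>P" for i
    have c: "[c i = d l i] (mod l)" if "l \<in> P" for i l
    proof -
      have "l dvd \<Prod>P" using P(1) that by (simp add: dvd_prod_eqI)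
      then have "[c i = x i] (mod l)" unfolding c_def cong_def by (simp add: mod_mod_cancel)
      moreover have "[x i = d l i] (mod l)" using x that by blast
      ultimately show ?thesis by (rule cong_trans)
    qed
    have "c i \<in> A" if "i < length ys" for i
    proof -
      have "W (\<lambda>_. c i)" by (rule W[of "\<lambda>l. d l i"]) (use c cong_sym d that in blast)+
      then show ?thesis using pos by (simp add: A c_def)
    qed
    moreover have "[(\<Sum>i<length ys. c i * ys ! i) = 0] (mod \<Prod>P)"
      unfolding zero
    proof
      fix l assume l: "l \<in> P"
      have "[(\<Sum>i<length ys. c i * ys ! i) = (\<Sum>i<length ys. d l i * ys ! i)] (mod l)"
        by (intro cong_sum cong_mult cong_refl c l)
      moreover have "[(\<Sum>i<length ys. d l i * ys ! i) = 0] (mod l)" using d l by blast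
      ultimately show "[(\<Sum>i<length ys. c i * ys ! i) = 0] (mod l)" by (rule cong_trans)
    qed
    ultimately show ?L by blast
  qed
  then show ?thesis by (simp add: weighted_zero_sum_iff_fun)
qed

section \<open>Unit weights and linked weights modulo a product of primes\<close>

lemma Zmod_eq: "Zmod m = {0..<m}"
  by (auto simp: Zmod_def residue_ring_def)

lemma U_prod_primes:
  fixes P :: "int set"
  assumes P: "finite P" "\<And>l. l \<in> P \<Longrightarrow> prime l" "P \<noteq> {}"
  shows "a \<in> U (\<Prod>P) \<longleftrightarrow> 0 \<le> a \<and> a < \<Prod>P \<and> (\<forall>l\<in>P. \<not> l dvd a)"
proof -
  obtain k where k: "k \<in> P" using P(3) by blast
  have "\<Prod>P > 0" by (rule prod_pos) (use P prime_gt_0_int in auto)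
  moreover have "k dvd \<Prod>P" using P(1) k by (simp add: dvd_prod_eqI)
  ultimately have "k \<le> \<Prod>P" by (rule zdvd_imp_le[rotated])
  then have "\<Prod>P > 1" using P(2)[OF k] prime_gt_1_int[of k] by simp
  then interpret residues "\<Prod>P" "residue_ring (\<Prod>P)" by unfold_locales simp_all
  have "coprime a (\<Prod>P) \<longleftrightarrow> (\<forall>l\<in>P. \<not> l dvd a)"
  proof
    assume "coprime a (\<Prod>P)"
    then show "\<forall>l\<in>P. \<not> l dvd a"
      using P by (meson coprime_common_divisor dvd_prod_eqI not_prime_unit)
  next
    assume "\<forall>l\<in>P. \<not> l dvd a"
    then show "coprime a (\<Prod>P)"
      using P(2) by (intro prod_coprime_right) (metis coprime_commute prime_imp_coprime)
  qed
  \<comment> \<open>\<open>res_units_eq\<close> asks for \<open>0 < a\<close>, the claim for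
    \<open>0 \<le> a\<close>; zero is excluded because the prime \<open>k\<close> divides
    it.\<close>
  moreover have "\<not> (\<forall>l\<in>P. \<not> l dvd 0)" using k by auto
  ultimately show ?thesis unfolding U_def res_units_eq by (cases "a = 0") auto
qed

lemma card_support_eq: "card {i \<in> {..<length ys}. Q (ys ! i)} = length (filter Q ys)"
  by (simp add: length_filter_conv_card)

text \<open>Being a unit is a separate condition at each prime, so the weights at different primes
  are independent and the criterion for one prime is applied to each.\<close>

lemma weighted_zero_sum_U_iff:
  fixes P :: "int set"
  assumes P: "finite P" "\<And>l. l \<in> P \<Longrightarrow> prime l" "P \<noteq> {}" and P7: "\<And>l. l \<in> P \<Longrightarrow> l \<ge> 7"
  shows "weighted_zero_sum (\<Prod>P) (U (\<Prod>P)) ys \<longleftrightarrow>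
    ys \<noteq> [] \<and> (\<forall>l\<in>P. balanced (\<lambda>y. \<not> l dvd y) ys)"
proof -
  have "weighted_zero_sum (\<Prod>P) (U (\<Prod>P)) ys \<longleftrightarrow> ys \<noteq> [] \<and>
    (\<exists>d. (\<forall>i<length ys. \<forall>l\<in>P. \<not> l dvd d l i) \<and> (\<forall>l\<in>P. [(\<Sum>i<length ys. d l i * ys ! i) = 0] (mod l)))"
    by (rule weighted_zero_sum_iff_local[OF P(1,2)])
      (use U_prod_primes[OF P] cong_dvd_iff in \<open>auto dest: cong_dvd_iff\<close>)
  also have "(\<exists>d. (\<forall>i<length ys. \<forall>l\<in>P. \<not> l dvd d l i) \<and> (\<forall>l\<in>P. [(\<Sum>i<length ys. d l i * ys ! i) = 0] (mod l))) \<longleftrightarrow>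
    (\<forall>l\<in>P. \<exists>c. (\<forall>i\<in>{..<length ys}. \<not> l dvd c i) \<and> [(\<Sum>i<length ys. c i * ys ! i) = 0] (mod l))" (is "?L = ?R")
  proof
    assume ?L
    then show ?R by auto
  next
    assume ?R
    then obtain d where "\<forall>l\<in>P. (\<forall>i\<in>{..<length ys}. \<not> l dvd d l i) \<and> [(\<Sum>i<length ys. d l i * ys ! i) = 0] (mod l)"
      by metis
    then show ?L by (intro exI[of _ d]) simp
  qed
  also have "\<dots> \<longleftrightarrow> (\<forall>l\<in>P. balanced (\<lambda>y. \<not> l dvd y) ys)"
    using unit_zero_sum_iff[OF P(2) P7 finite_lessThan]
    by (simp add: balanced_def length_filter_conv_card)
  finally show ?thesis .
qed

text \<open>By multiplicativity the two symbols agree iff an even number of -1, \<open>a\<close> and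
  \<open>b\<close> have different characters at \<open>q\<close> and \<open>r\<close>; for three
  truth values this parity is the iterated equality.\<close>

lemma Legendre_neg_mult_eq_iff:
  fixes q r :: int
  assumes q: "prime q" "q > 2" and r: "prime r" "r > 2"
    and "\<not> q dvd a" "\<not> q dvd b" "\<not> r dvd a" "\<not> r dvd b"
  shows "Legendre (- (a * b)) q = Legendre (- (a * b)) r \<longleftrightarrow>
    ((Legendre a q = Legendre a r) = (Legendre b q = Legendre b r)) = (Legendre (-1) q = Legendre (-1) r)"
proof -
  have eq: "Legendre (- (a * b)) l = Legendre (-1) l * (Legendre a l * Legendre b l)"
    if "prime l" "l > 2" for l
    using Legendre_mult[OF that, of "-1" "a * b"] Legendre_mult[OF that, of a b] by simp
  have "\<not> q dvd -1" "\<not> r dvd -1" using q r by auto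
  then have "Legendre (-1) q = 1 \<or> Legendre (-1) q = -1" "Legendre (-1) r = 1 \<or> Legendre (-1) r = -1"
    "Legendre a q = 1 \<or> Legendre a q = -1" "Legendre a r = 1 \<or> Legendre a r = -1"
    "Legendre b q = 1 \<or> Legendre b q = -1" "Legendre b r = 1 \<or> Legendre b r = -1"
    using assms Legendre_sign by blast+
  then show ?thesis unfolding eq[OF q] eq[OF r] by (elim disjE) simp_all
qed

text \<open>Serves both weight sets: \<open>L\<close> with three primes in \<open>P\<close> and
  \<open>S\<close> with two. Only \<open>q\<close> and \<open>r\<close> are linked; at any other
  prime the weights are free units.\<close>

lemma weighted_zero_sum_linked_iff:
  fixes P :: "int set"
  assumes P: "finite P" "\<And>l. l \<in> P \<Longrightarrow> prime l" and P7: "\<And>l. l \<in> P \<Longrightarrow> l \<ge> 7"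
    and qr: "q \<in> P" "r \<in> P" "q \<noteq> r"
  shows "weighted_zero_sum (\<Prod>P) {a \<in> U (\<Prod>P). Legendre a q = Legendre a r} ys \<longleftrightarrow>
    ys \<noteq> [] \<and> (\<forall>l\<in>P. balanced (\<lambda>y. \<not> l dvd y) ys) \<and>
    \<not> clash (Legendre (-1) q = Legendre (-1) r) (\<lambda>y. \<not> q dvd y) (\<lambda>y. \<not> r dvd y)
        (\<lambda>y. \<not> q dvd y \<and> \<not> r dvd y \<and> Legendre y q = Legendre y r) ys"
proof -
  define k where "k = length ys"
  define good where "good l c \<longleftrightarrow> (\<forall>i\<in>{..<k}. \<not> l dvd c i) \<and> [(\<Sum>i<k. c i * ys ! i) = 0] (mod l)" for l and c :: "nat \<Rightarrow> int"
  have ne: "P \<noteq> {}" using qr by blast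
  define W where "W f \<longleftrightarrow> (\<forall>l\<in>P. \<not> l dvd f l) \<and> Legendre (f q) q = Legendre (f r) r" for f
  have "weighted_zero_sum (\<Prod>P) {a \<in> U (\<Prod>P). Legendre a q = Legendre a r} ys \<longleftrightarrow> ys \<noteq> [] \<and>
    (\<exists>d. (\<forall>i<length ys. W (\<lambda>l. d l i)) \<and> (\<forall>l\<in>P. [(\<Sum>i<length ys. d l i * ys ! i) = 0] (mod l)))"
  proof (rule weighted_zero_sum_iff_local[OF P])
    show "a \<in> {a \<in> U (\<Prod>P). Legendre a q = Legendre a r} \<longleftrightarrow> 0 \<le> a \<and> a < \<Prod>P \<and> W (\<lambda>_. a)" for a
      using U_prod_primes[OF P ne] by (auto simp: W_def)
    show "W g" if "\<And>l. l \<in> P \<Longrightarrow> [f l = g l] (mod l)" "W f" for f g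
    proof -
      have "l dvd f l \<longleftrightarrow> l dvd g l" "Legendre (f l) l = Legendre (g l) l" if "l \<in> P" for l
        using \<open>\<And>l. l \<in> P \<Longrightarrow> [f l = g l] (mod l)\<close>[OF that] by (rule cong_dvd_iff, rule Legendre_cong)
      then show ?thesis using \<open>W f\<close> qr by (simp add: W_def)
    qed
  qed
  also have "(\<exists>d. (\<forall>i<length ys. W (\<lambda>l. d l i)) \<and> (\<forall>l\<in>P. [(\<Sum>i<length ys. d l i * ys ! i) = 0] (mod l))) \<longleftrightarrow>
    (\<forall>l\<in>P. \<exists>c. good l c) \<and>
    (\<exists>c d. (\<forall>i\<in>{..<k}. \<not> q dvd c i \<and> \<not> r dvd d i \<and> Legendre (c i) q = Legendre (d i) r) \<and>
      [(\<Sum>i<k. c i * ys ! i) = 0] (mod q) \<and> [(\<Sum>i<k. d i * ys ! i) = 0] (mod r))" (is "?L \<longleftrightarrow> ?R1 \<and> ?R2")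
  proof
    assume ?L
    then obtain d where d: "\<forall>i<length ys. W (\<lambda>l. d l i)"
        "\<forall>l\<in>P. [(\<Sum>i<length ys. d l i * ys ! i) = 0] (mod l)" by blast
    then have "\<forall>l\<in>P. good l (d l)" by (simp add: good_def W_def k_def)
    moreover have ?R2 using d qr
      by (intro exI[of _ "d q"] exI[of _ "d r"]) (simp add: W_def k_def)
    ultimately show "?R1 \<and> ?R2" by blast
  next
    assume R: "?R1 \<and> ?R2"
    then have "\<forall>l\<in>P. \<exists>c. good l c" by blast
    then obtain f where f: "\<forall>l\<in>P. good l (f l)" by (rule bchoice[THEN exE])
    from R obtain c d where cd: "\<forall>i\<in>{..<k}. \<not> q dvd c i \<and> \<not> r dvd d i \<and> Legendre (c i) q = Legendre (d i) r"
      "[(\<Sum>i<k. c i * ys ! i) = 0] (mod q)" "[(\<Sum>i<k. d i * ys ! i) = 0] (mod r)" by blast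
    then show ?L using f qr(3)
      by (intro exI[of _ "f(q := c, r := d)"]) (auto simp: W_def k_def good_def)
  qed
  also have "?R1 \<longleftrightarrow> (\<forall>l\<in>P. balanced (\<lambda>y. \<not> l dvd y) ys)"
  proof (rule ball_cong[OF refl])
    fix l assume "l \<in> P"
    then show "(\<exists>c. good l c) \<longleftrightarrow> balanced (\<lambda>y. \<not> l dvd y) ys"
      using unit_zero_sum_iff[OF P(2) P7 finite_lessThan, of l k "(!) ys"]
      by (simp add: balanced_def length_filter_conv_card good_def k_def)
  qed
  also have "?R2 \<longleftrightarrow> balanced (\<lambda>y. \<not> q dvd y) ys \<and> balanced (\<lambda>y. \<not> r dvd y) ys \<and>
    \<not> clash (Legendre (-1) q = Legendre (-1) r) (\<lambda>y. \<not> q dvd y) (\<lambda>y. \<not> r dvd y)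
        (\<lambda>y. \<not> q dvd y \<and> \<not> r dvd y \<and> Legendre y q = Legendre y r) ys"
  proof -
    have "q > 2" "r > 2" using P7[OF qr(1)] P7[OF qr(2)] by simp_all
    then have clash_eq: "clash (Legendre (-1) q = Legendre (-1) r) (\<lambda>y. \<not> q dvd y) (\<lambda>y. \<not> r dvd y)
        (\<lambda>y. \<not> q dvd y \<and> \<not> r dvd y \<and> Legendre y q = Legendre y r) ys \<longleftrightarrow>
      \<not> (\<forall>i j. {i \<in> {..<length ys}. \<not> q dvd ys ! i} = {i, j} \<longrightarrow> {i \<in> {..<length ys}. \<not> r dvd ys ! i} = {i, j} \<longrightarrow>
        i \<noteq> j \<longrightarrow> Legendre (- (ys ! i * ys ! j)) q = Legendre (- (ys ! i * ys ! j)) r)"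
      by (intro clash_iff_nth) (simp_all add: mult.commute Legendre_neg_mult_eq_iff P qr)
    then show ?thesis
      unfolding k_def linked_zero_sum_iff[OF P(2)[OF qr(1)] P7[OF qr(1)] P(2)[OF qr(2)] P7[OF qr(2)] finite_lessThan]
        card_support_eq[of ys "\<lambda>y. \<not> q dvd y"] card_support_eq[of ys "\<lambda>y. \<not> r dvd y"] balanced_def clash_eq by (simp only: not_not)
  qed
  finally show ?thesis using qr by blast
qed

section \<open>The finite check on profiles\<close>

text \<open>Evaluable counterpart of \<open>has_weighted_zero_sum_subseq\<close>, searching the
  finite list of subsequences.\<close>

definition hits :: "('a list \<Rightarrow> bool) \<Rightarrow> 'a list \<Rightarrow> bool" where
  "hits P xs \<longleftrightarrow> list_ex (\<lambda>ys. ys \<noteq> [] \<and> P ys) (subseqs xs)"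

type_synonym profile = "bool \<times> bool \<times> bool \<times> bool"

definition at_p :: "profile \<Rightarrow> bool" where "at_p = (\<lambda>(a, b, c, d). a)"
definition at_q :: "profile \<Rightarrow> bool" where "at_q = (\<lambda>(a, b, c, d). b)"
definition at_r :: "profile \<Rightarrow> bool" where "at_r = (\<lambda>(a, b, c, d). c)"
definition agree :: "profile \<Rightarrow> bool" where "agree = (\<lambda>(a, b, c, d). d)"

definition profile :: "int \<Rightarrow> int \<Rightarrow> int \<Rightarrow> int \<Rightarrow> profile" where
  "profile p q r y = (\<not> p dvd y, \<not> q dvd y, \<not> r dvd y,
     \<not> q dvd y \<and> \<not> r dvd y \<and> Legendre y q = Legendre y r)"

text \<open>
  The last component of a profile is \<open>False\<close> whenever \<open>q\<close> or \<open>r\<close> divides the term, which leaves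
  ten possible profiles.
\<close>

definition profiles :: "profile list" where
  "profiles = [(a, b). a \<leftarrow> [False, True], b \<leftarrow> [(False, False, False), (True, False, False),
     (False, True, False), (True, True, False), (True, True, True)]]"

lemma profile_in_profiles: "profile p q r y \<in> set profiles"
  by (auto simp: profile_def profiles_def)

text \<open>Primed names and \<open>zero_sum_S\<close> refer to the modulus \<open>q r\<close>, the others to \<open>p q r\<close>.\<close>

definition zero_sum_U' :: "profile list \<Rightarrow> bool" where
  "zero_sum_U' ys \<longleftrightarrow> balanced at_q ys \<and> balanced at_r ys"

definition zero_sum_S :: "bool \<Rightarrow> profile list \<Rightarrow> bool" where
  "zero_sum_S c ys \<longleftrightarrow> zero_sum_U' ys \<and> \<not> clash c at_q at_r agree ys"

definition zero_sum_U :: "profile list \<Rightarrow> bool" where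
  "zero_sum_U ys \<longleftrightarrow> balanced at_p ys \<and> zero_sum_U' ys"

definition zero_sum_L :: "bool \<Rightarrow> profile list \<Rightarrow> bool" where
  "zero_sum_L c ys \<longleftrightarrow> zero_sum_U ys \<and> \<not> clash c at_q at_r agree ys"

text \<open>Forms (i) and (ii) of the theorem, read off profiles. Two terms are extremal modulo
  \<open>q r\<close> iff they have no zero-sum subsequence, the Davenport constants there being 3; a
  nonzero multiple of \<open>q r\<close> is a term divisible by \<open>q\<close> and
  \<open>r\<close> but not by \<open>p\<close>.\<close>

definition exceptional :: "bool \<Rightarrow> profile \<Rightarrow> profile \<Rightarrow> profile \<Rightarrow> bool" where
  "exceptional c x1 x2 x3 \<longleftrightarrow>
     (if \<not> hits (zero_sum_S c) [x1, x2] then at_p x3 \<and> \<not> at_q x3 \<and> \<not> at_r x3 else False) \<or>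
     (if at_p x1 \<and> \<not> at_p x2 \<and> \<not> at_p x3
      then \<not> hits (zero_sum_S c) [x2, x3] \<and> hits zero_sum_U' [x2, x3] else False)"

text \<open>
  Conditionals replace disjunctions in the following statements (and in \<^const>\<open>exceptional\<close>)
  because the simplifier evaluates them lazily.
\<close>

lemma hits_zero_sum_S_check:
  "list_all (\<lambda>c. list_all (\<lambda>x. list_all (\<lambda>y. list_all (\<lambda>z.
     hits (zero_sum_S c) [x, y, z]) profiles) profiles) profiles) [False, True]"
  by code_simp

lemma hits_zero_sum_L_check:
  "list_all (\<lambda>c. list_all (\<lambda>x. list_all (\<lambda>y. if hits (zero_sum_L c) [x, y] then True else
     list_all (\<lambda>z. if hits (zero_sum_L c) [x, y, z] then True else
     list_all (\<lambda>w. hits (zero_sum_L c) [x, y, z, w]) profiles) profiles) profiles) profiles) [False, True]"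
  by code_simp

lemma extremal_L_check:
  "list_all (\<lambda>c. list_all (\<lambda>x. list_all (\<lambda>y. list_all (\<lambda>z.
     \<not> hits (zero_sum_L c) [x, y, z] \<longleftrightarrow>
       (if \<not> hits zero_sum_U [x, y, z] then True else
        if exceptional c x y z then True else if exceptional c x z y then True else
        if exceptional c y x z then True else if exceptional c y z x then True else
        if exceptional c z x y then True else exceptional c z y x)) profiles) profiles) profiles) [False, True]"
  by code_simp

lemma subseq_hits:
  assumes "hits P xs" "subseq xs ys"
  shows "hits P ys"
proof -
  obtain zs where zs: "subseq zs xs" "zs \<noteq> []" "P zs"
    using assms(1) by (auto simp: hits_def list_ex_iff)
  have "subseq zs ys" using zs(1) assms(2) by (rule subseq_order.order_trans)
  then show ?thesis using zs(2,3) by (auto simp: hits_def list_ex_iff)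
qed

lemma hits_zero_sum_S:
  assumes "x \<in> set profiles" "y \<in> set profiles" "z \<in> set profiles"
  shows "hits (zero_sum_S c) [x, y, z]"
  using hits_zero_sum_S_check assms unfolding list_all_iff by (cases c) simp_all

lemma hits_zero_sum_L:
  assumes "x \<in> set profiles" "y \<in> set profiles" "z \<in> set profiles" "w \<in> set profiles"
  shows "hits (zero_sum_L c) [x, y, z, w]"
proof -
  \<comment> \<open>The check stops at the first initial segment with a hit; by
    \<open>subseq_hits\<close> this is a hit of the whole list.\<close>
  have "hits (zero_sum_L c) [x, y] \<or> hits (zero_sum_L c) [x, y, z] \<or> hits (zero_sum_L c) [x, y, z, w]"
    using hits_zero_sum_L_check assms unfolding list_all_iff by (cases c) (simp_all split: if_splits, blast+)
  moreover have "subseq [x, y] [x, y, z, w]" "subseq [x, y, z] [x, y, z, w]" by simp_all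
  ultimately show ?thesis using subseq_hits by blast
qed

lemma extremal_L_iff:
  assumes "x \<in> set profiles" "y \<in> set profiles" "z \<in> set profiles"
  shows "\<not> hits (zero_sum_L c) [x, y, z] \<longleftrightarrow> \<not> hits zero_sum_U [x, y, z] \<or>
    exceptional c x y z \<or> exceptional c x z y \<or> exceptional c y x z \<or>
    exceptional c y z x \<or> exceptional c z x y \<or> exceptional c z y x"
  using extremal_L_check assms unfolding list_all_iff
  by (cases c) (simp_all split: if_splits)

section \<open>Extremal sequences\<close>

lemma weighted_zero_sum_nat_map:
  "weighted_zero_sum m A (map (nat_map m) ys) \<longleftrightarrow> weighted_zero_sum m A ys"
proof -
  have "[(\<Sum>i<length ys. c i * map (nat_map m) ys ! i) = (\<Sum>i<length ys. c i * ys ! i)] (mod m)" for c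
    by (intro cong_sum cong_mult cong_refl) (simp add: nat_map_def cong_def)
  then have "[(\<Sum>i<length ys. c i * map (nat_map m) ys ! i) = 0] (mod m) \<longleftrightarrow>
      [(\<Sum>i<length ys. c i * ys ! i) = 0] (mod m)" for c
    using cong_trans cong_sym by meson
  then show ?thesis by (simp add: weighted_zero_sum_iff_fun)
qed

lemma map_subseqs: "subseqs (map f xs) = map (map f) (subseqs xs)"
  by (induction xs) (simp_all add: Let_def comp_def)

lemma has_weighted_zero_sum_subseq_iff_hits:
  assumes "\<And>ys. weighted_zero_sum m A ys \<longleftrightarrow> ys \<noteq> [] \<and> P (map f ys)"
  shows "has_weighted_zero_sum_subseq m A xs \<longleftrightarrow> hits P (map f xs)"
  unfolding has_weighted_zero_sum_subseq_def hits_def map_subseqs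
  by (auto simp: assms list_ex_iff)

lemma has_weighted_zero_sum_subseq_nat_map:
  "has_weighted_zero_sum_subseq m A (map (nat_map m) xs) \<longleftrightarrow> has_weighted_zero_sum_subseq m A xs"
proof -
  have "has_weighted_zero_sum_subseq m A (map (nat_map m) xs) \<longleftrightarrow>
    (\<exists>ys\<in>set (subseqs (map (nat_map m) xs)). weighted_zero_sum m A ys)"
    by (auto simp: has_weighted_zero_sum_subseq_def)
  also have "\<dots> \<longleftrightarrow> has_weighted_zero_sum_subseq m A xs"
    unfolding map_subseqs by (auto simp: has_weighted_zero_sum_subseq_def weighted_zero_sum_nat_map)
  finally show ?thesis .
qed

text \<open>A sequence without zero-sum subsequence rules out every smaller length through its
  initial segments.\<close>

lemma Davenport_eqI:
  assumes "\<And>xs. set xs \<subseteq> Zmod m \<Longrightarrow> length xs = Suc k \<Longrightarrow> has_weighted_zero_sum_subseq m A xs"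
    and zs: "set zs \<subseteq> Zmod m" "length zs = k" "\<not> has_weighted_zero_sum_subseq m A zs"
  shows "Davenport m A = Suc k"
  unfolding Davenport_def
proof (rule Least_equality)
  fix j assume j: "0 < j \<and> (\<forall>xs. set xs \<subseteq> Zmod m \<and> length xs = j \<longrightarrow> has_weighted_zero_sum_subseq m A xs)"
  show "Suc k \<le> j"
  proof (rule ccontr)
    assume "\<not> Suc k \<le> j"
    then have "length (take j zs) = j" "set (take j zs) \<subseteq> Zmod m"
      using zs set_take_subset by fastforce+
    then have "has_weighted_zero_sum_subseq m A (take j zs)" using j by blast
    then obtain ys where ys: "subseq ys (take j zs)" "weighted_zero_sum m A ys"
      unfolding has_weighted_zero_sum_subseq_def by blast
    have "subseq (take j zs) zs" by (simp add: prefix_imp_subseq take_is_prefix)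
    with ys(1) have "subseq ys zs" by (rule subseq_order.order_trans)
    then show False using zs(3) ys(2) unfolding has_weighted_zero_sum_subseq_def by blast
  qed
qed (use assms(1) in auto)

lemma balanced_map: "balanced Q (map f ys) \<longleftrightarrow> balanced (\<lambda>y. Q (f y)) ys"
  by (simp add: balanced_def filter_map comp_def)

lemma clash_map: "clash c Q R s (map f ys) \<longleftrightarrow> clash c (\<lambda>y. Q (f y)) (\<lambda>y. R (f y)) (\<lambda>y. s (f y)) ys"
  unfolding clash_def filter_map map_map comp_def by (simp split: list.splits)

lemma mset_eq_triple:
  "mset [a, b, d] = mset [x, y, z] \<longleftrightarrow> [a, b, d] \<in> {[x, y, z], [x, z, y], [y, x, z], [y, z, x], [z, x, y], [z, y, x]}"
  by (auto simp: add_eq_conv_ex)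

lemma ex_permutation_triple:
  "(\<exists>x y z. mset [a, b, d] = mset [x, y, z] \<and> F x y z) \<longleftrightarrow>
   F a b d \<or> F a d b \<or> F b a d \<or> F b d a \<or> F d a b \<or> F d b a"
  unfolding mset_eq_triple by auto

section \<open>The modulus \<open>p q r\<close> with distinguished prime \<open>p\<close>\<close>

locale three_primes =
  fixes p q r :: int
  assumes primes: "prime p" "prime q" "prime r"
    and ge7: "p \<ge> 7" "q \<ge> 7" "r \<ge> 7"
    and primes_distinct: "p \<noteq> q" "p \<noteq> r" "q \<noteq> r"
begin

abbreviation (input) prof :: "int \<Rightarrow> profile" where "prof \<equiv> profile p q r"
abbreviation (input) same_sign :: bool where "same_sign \<equiv> Legendre (-1) q = Legendre (-1) r"

lemma prod_pqr: "\<Prod>{p, q, r} = p * q * r" and prod_qr: "\<Prod>{q, r} = q * r"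
  using primes_distinct by simp_all

lemma set_pqr: "finite {p, q, r}" "\<And>l. l \<in> {p, q, r} \<Longrightarrow> prime l" "{p, q, r} \<noteq> {}"
    "\<And>l. l \<in> {p, q, r} \<Longrightarrow> l \<ge> 7"
  and set_qr: "finite {q, r}" "\<And>l. l \<in> {q, r} \<Longrightarrow> prime l" "{q, r} \<noteq> {}"
    "\<And>l. l \<in> {q, r} \<Longrightarrow> l \<ge> 7"
  using primes ge7 by auto

lemma prime_factorization_qr: "prime_factorization (q * r) = {#q, r#}"
  using primes ge7 by (simp add: prime_factorization_mult prime_factorization_prime)

lemma prime_factorization_pqr: "prime_factorization (p * q * r) = {#p, q, r#}"
  using primes ge7 by (simp add: prime_factorization_mult prime_factorization_prime)

text \<open>The Jacobi symbol at \<open>p q r\<close> is a product of three signs; cancelling the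
  one at \<open>p\<close> leaves that the signs at \<open>q\<close> and \<open>r\<close> have
  product 1, that is, agree.\<close>

lemma L_eq: "L (p * q * r) p = {a \<in> U (p * q * r). Legendre a q = Legendre a r}"
proof -
  have "Jacobi a (p * q * r) = Jacobi a p \<longleftrightarrow> Legendre a q = Legendre a r" if "a \<in> U (p * q * r)" for a
  proof -
    have "\<not> p dvd a" "\<not> q dvd a" "\<not> r dvd a"
      using that U_prod_primes[OF set_pqr(1-3)] by (simp_all add: prod_pqr)
    then have "Legendre a p = 1 \<or> Legendre a p = -1" "Legendre a q = 1 \<or> Legendre a q = -1"
      "Legendre a r = 1 \<or> Legendre a r = -1" using Legendre_sign by blast+
    then show ?thesis
      by (auto simp: Jacobi_def prime_factorization_pqr prime_factorization_prime primes)
  qed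
  then show ?thesis by (auto simp: L_def)
qed

lemma S_eq: "S (q * r) = {a \<in> U (q * r). Legendre a q = Legendre a r}"
proof -
  have "Jacobi a (q * r) = 1 \<longleftrightarrow> Legendre a q = Legendre a r" if "a \<in> U (q * r)" for a
  proof -
    have "\<not> q dvd a" "\<not> r dvd a"
      using that U_prod_primes[OF set_qr(1-3)] by (simp_all add: prod_qr)
    then have "Legendre a q = 1 \<or> Legendre a q = -1"
      "Legendre a r = 1 \<or> Legendre a r = -1" using Legendre_sign by blast+
    then show ?thesis by (auto simp: Jacobi_def prime_factorization_qr)
  qed
  then show ?thesis by (auto simp: S_def)
qed

text \<open>Here and in the next three lemmas zero-sum questions pass to profiles. The same profiles
  serve both moduli, so that conditions modulo \<open>p q r\<close> and \<open>q r\<close> can be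
  compared in one check.\<close>

lemma has_U: "has_weighted_zero_sum_subseq (p * q * r) (U (p * q * r)) xs \<longleftrightarrow> hits zero_sum_U (map prof xs)"
  using weighted_zero_sum_U_iff[OF set_pqr]
  by (intro has_weighted_zero_sum_subseq_iff_hits)
    (simp add: prod_pqr zero_sum_U_def zero_sum_U'_def balanced_map at_p_def at_q_def at_r_def profile_def)

lemma has_U': "has_weighted_zero_sum_subseq (q * r) (U (q * r)) xs \<longleftrightarrow> hits zero_sum_U' (map prof xs)"
  using weighted_zero_sum_U_iff[OF set_qr]
  by (intro has_weighted_zero_sum_subseq_iff_hits)
    (simp add: prod_qr zero_sum_U'_def balanced_map at_q_def at_r_def profile_def)

lemma has_L: "has_weighted_zero_sum_subseq (p * q * r) (L (p * q * r) p) xs \<longleftrightarrow> hits (zero_sum_L same_sign) (map prof xs)"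
  using weighted_zero_sum_linked_iff[OF set_pqr(1,2,4), of q r] primes_distinct
  by (intro has_weighted_zero_sum_subseq_iff_hits)
    (simp add: prod_pqr L_eq zero_sum_L_def zero_sum_U_def zero_sum_U'_def balanced_map clash_map
      at_p_def at_q_def at_r_def agree_def profile_def)

lemma has_S: "has_weighted_zero_sum_subseq (q * r) (S (q * r)) xs \<longleftrightarrow> hits (zero_sum_S same_sign) (map prof xs)"
  using weighted_zero_sum_linked_iff[OF set_qr(1,2,4), of q r] primes_distinct
  by (intro has_weighted_zero_sum_subseq_iff_hits)
    (simp add: prod_qr S_eq zero_sum_S_def zero_sum_U'_def balanced_map clash_map
      at_q_def at_r_def agree_def profile_def)

lemma zero_sum_L_imp_U: "hits (zero_sum_L c) ys \<Longrightarrow> hits zero_sum_U ys"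
  and zero_sum_S_imp_U': "hits (zero_sum_S c) ys \<Longrightarrow> hits zero_sum_U' ys"
  by (auto simp: hits_def list_ex_iff zero_sum_L_def zero_sum_S_def)

lemma not_dvd_primes:
  "\<not> p dvd q" "\<not> p dvd r" "\<not> q dvd p" "\<not> q dvd r" "\<not> r dvd p" "\<not> r dvd q"
  using primes primes_distinct primes_dvd_imp_eq by metis+

lemma Davenport_L: "Davenport (p * q * r) (L (p * q * r) p) = 4"
  and Davenport_U: "Davenport (p * q * r) (U (p * q * r)) = 4"
proof -
  have pos: "p > 1" "q > 1" "r > 1" using ge7 by auto
  then have Z: "set [q * r, p * r, p * q] \<subseteq> Zmod (p * q * r)"
    by (simp add: Zmod_eq mult.commute[of p q] mult.assoc)
  \<comment> \<open>Each product is nonzero modulo exactly one prime, a different one for each, so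
    any nonempty subsequence has exactly one nonzero term modulo some prime.\<close>
  have "map prof [q * r, p * r, p * q] =
      [(True, False, False, False), (False, True, False, False), (False, False, True, False)]"
    using primes not_dvd_primes by (simp add: profile_def prime_dvd_mult_iff)
  then have free: "\<not> hits zero_sum_U (map prof [q * r, p * r, p * q])"
    by (simp add: hits_def zero_sum_U_def zero_sum_U'_def balanced_def at_p_def at_q_def at_r_def)
  \<comment> \<open>By \<open>zero_sum_L_imp_U\<close> the upper bound for \<open>L\<close> and the
    lower bound for \<open>U\<close> hold for both weight sets.\<close>
  have hit: "hits (zero_sum_L same_sign) (map prof xs)" if "length xs = Suc 3" for xs
    using that hits_zero_sum_L[OF profile_in_profiles profile_in_profiles profile_in_profiles profile_in_profiles]
    by (auto simp: length_Suc_conv numeral_3_eq_3)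
  have "Davenport (p * q * r) (L (p * q * r) p) = Suc 3"
    by (rule Davenport_eqI[OF _ Z]) (use hit free zero_sum_L_imp_U in \<open>auto simp only: has_L, simp\<close>)
  moreover have "Davenport (p * q * r) (U (p * q * r)) = Suc 3"
    by (rule Davenport_eqI[OF _ Z]) (use hit free zero_sum_L_imp_U in \<open>auto simp only: has_U, simp\<close>)
  ultimately show "Davenport (p * q * r) (L (p * q * r) p) = 4" "Davenport (p * q * r) (U (p * q * r)) = 4"
    by simp_all
qed

lemma Davenport_S: "Davenport (q * r) (S (q * r)) = 3"
  and Davenport_U': "Davenport (q * r) (U (q * r)) = 3"
proof -
  have pos: "q > 1" "r > 1" using ge7 by auto
  then have Z: "set [q, r] \<subseteq> Zmod (q * r)" by (simp add: Zmod_eq)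
  have "map prof [q, r] = [(True, False, True, False), (True, True, False, False)]"
    using not_dvd_primes by (simp add: profile_def)
  then have free: "\<not> hits zero_sum_U' (map prof [q, r])"
    by (simp add: hits_def zero_sum_U'_def balanced_def at_q_def at_r_def)
  have hit: "hits (zero_sum_S same_sign) (map prof xs)" if "length xs = Suc 2" for xs
    using that hits_zero_sum_S[OF profile_in_profiles profile_in_profiles profile_in_profiles]
    by (auto simp: length_Suc_conv numeral_2_eq_2)
  have "Davenport (q * r) (S (q * r)) = Suc 2"
    by (rule Davenport_eqI[OF _ Z]) (use hit free zero_sum_S_imp_U' in \<open>auto simp only: has_S, simp\<close>)
  moreover have "Davenport (q * r) (U (q * r)) = Suc 2"
    by (rule Davenport_eqI[OF _ Z]) (use hit free zero_sum_S_imp_U' in \<open>auto simp only: has_U', simp\<close>)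
  ultimately show "Davenport (q * r) (S (q * r)) = 3" "Davenport (q * r) (U (q * r)) = 3"
    by simp_all
qed

lemma D_extremal_S_iff:
  "D_extremal (q * r) (S (q * r)) (map (nat_map (q * r)) [x, y]) \<longleftrightarrow> \<not> hits (zero_sum_S same_sign) [prof x, prof y]"
  and D_extremal_U'_iff:
  "D_extremal (q * r) (U (q * r)) (map (nat_map (q * r)) [x, y]) \<longleftrightarrow> \<not> hits zero_sum_U' [prof x, prof y]"
proof -
  have "q * r > 0" using ge7 by simp
  then have Z: "set (map (nat_map (q * r)) [x, y]) \<subseteq> Zmod (q * r)" by (simp add: Zmod_eq nat_map_def)
  show "D_extremal (q * r) (S (q * r)) (map (nat_map (q * r)) [x, y]) \<longleftrightarrow> \<not> hits (zero_sum_S same_sign) [prof x, prof y]"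
    unfolding D_extremal_def Davenport_S has_weighted_zero_sum_subseq_nat_map has_S using Z by simp
  show "D_extremal (q * r) (U (q * r)) (map (nat_map (q * r)) [x, y]) \<longleftrightarrow> \<not> hits zero_sum_U' [prof x, prof y]"
    unfolding D_extremal_def Davenport_U' has_weighted_zero_sum_subseq_nat_map has_U' using Z by simp
qed

lemma nonzero_multiple_iff:
  assumes "x \<in> Zmod (p * q * r)"
  shows "x \<noteq> 0 \<and> q * r dvd x \<longleftrightarrow> at_p (prof x) \<and> \<not> at_q (prof x) \<and> \<not> at_r (prof x)"
proof -
  have qr: "q * r dvd x \<longleftrightarrow> q dvd x \<and> r dvd x"
    using prod_primes_dvd_iff[OF set_qr(1,2), of x] by (simp add: prod_qr)
  have "p * q * r dvd x \<longleftrightarrow> p dvd x \<and> q dvd x \<and> r dvd x"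
    using prod_primes_dvd_iff[OF set_pqr(1,2), of x] by (simp add: prod_pqr)
  moreover have "p * q * r dvd x \<longleftrightarrow> x = 0"
    using assms zdvd_not_zless[of x "p * q * r"] by (cases "x = 0") (auto simp: Zmod_eq)
  ultimately show ?thesis using qr by (auto simp: at_p_def at_q_def at_r_def profile_def)
qed

lemma exceptional_iff:
  assumes "x3 \<in> Zmod (p * q * r)"
  shows "(D_extremal (q * r) (S (q * r)) (map (nat_map (q * r)) [x1, x2]) \<and> x3 \<noteq> 0 \<and> q * r dvd x3) \<or>
      (\<not> p dvd x1 \<and> p dvd x2 \<and> p dvd x3 \<and>
       D_extremal (q * r) (S (q * r)) (map (nat_map (q * r)) [x2, x3]) \<and>
       \<not> D_extremal (q * r) (U (q * r)) (map (nat_map (q * r)) [x2, x3])) \<longleftrightarrow>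
    exceptional same_sign (prof x1) (prof x2) (prof x3)"
proof -
  have "at_p (prof x) \<longleftrightarrow> \<not> p dvd x" for x by (simp add: at_p_def profile_def)
  then show ?thesis
    unfolding D_extremal_S_iff D_extremal_U'_iff nonzero_multiple_iff[OF assms] exceptional_def by auto
qed

lemma D_extremal_L_iff:
  assumes xs: "set xs \<subseteq> Zmod (p * q * r)"
  shows "D_extremal (p * q * r) (L (p * q * r) p) xs \<longleftrightarrow>
    D_extremal (p * q * r) (U (p * q * r)) xs \<or>
    (\<exists>x1 x2 x3. mset xs = mset [x1, x2, x3] \<and>
       ((D_extremal (q * r) (S (q * r)) (map (nat_map (q * r)) [x1, x2]) \<and> x3 \<noteq> 0 \<and> q * r dvd x3) \<or>
        (\<not> p dvd x1 \<and> p dvd x2 \<and> p dvd x3 \<and>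
         D_extremal (q * r) (S (q * r)) (map (nat_map (q * r)) [x2, x3]) \<and>
         \<not> D_extremal (q * r) (U (q * r)) (map (nat_map (q * r)) [x2, x3]))))"
    (is "?L \<longleftrightarrow> ?U \<or> (\<exists>x1 x2 x3. mset xs = mset [x1, x2, x3] \<and> ?E x1 x2 x3)")
proof (cases "length xs = 3")
  case False
  \<comment> \<open>Both Davenport constants are 4, so extremal sequences have length three and both
    sides are false for other lengths.\<close>
  then have "mset xs \<noteq> mset [x1, x2, x3]" for x1 x2 x3
    by (metis length_Cons list.size(3) mset_eq_length numeral_3_eq_3)
  with False show ?thesis unfolding D_extremal_def Davenport_L Davenport_U by simp
next
  case True
  then obtain a b d where abd: "xs = [a, b, d]"
    by (auto simp: length_Suc_conv numeral_3_eq_3)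
  have E: "?E x1 x2 x3 \<longleftrightarrow> exceptional same_sign (prof x1) (prof x2) (prof x3)"
    if "mset xs = mset [x1, x2, x3]" for x1 x2 x3
  proof (rule exceptional_iff)
    have "x3 \<in> set xs" using mset_eq_setD[OF that] by simp
    then show "x3 \<in> Zmod (p * q * r)" using xs by blast
  qed
  have "?L \<longleftrightarrow> \<not> hits (zero_sum_L same_sign) [prof a, prof b, prof d]"
    unfolding D_extremal_def Davenport_L has_L using xs abd by simp
  also have "\<dots> \<longleftrightarrow> \<not> hits zero_sum_U [prof a, prof b, prof d] \<or>
    (\<exists>x1 x2 x3. mset xs = mset [x1, x2, x3] \<and> exceptional same_sign (prof x1) (prof x2) (prof x3))"
    unfolding abd ex_permutation_triple
    by (rule extremal_L_iff[OF profile_in_profiles profile_in_profiles profile_in_profiles])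
  also have "\<not> hits zero_sum_U [prof a, prof b, prof d] \<longleftrightarrow> ?U"
    unfolding D_extremal_def Davenport_U has_U using xs abd by simp
  finally show ?thesis using E by blast
qed

end

theorem theorem6p4:
  fixes n p' n' :: int and xs :: "int list"
  assumes "n > 0" and "squarefree n"
    and "\<And>p. prime p \<Longrightarrow> p dvd n \<Longrightarrow> p \<ge> 7"
    and "prime p'" and "p' dvd n"
    and "card (prime_factors n) = 3"
    and "n' = n div p'"
    and "set xs \<subseteq> Zmod n"
  shows "D_extremal n (L n p') xs \<longleftrightarrow>
    D_extremal n (U n) xs \<or>
    (\<exists>x1 x2 x3. mset xs = mset [x1, x2, x3] \<and>
       ((D_extremal n' (S n') (map (nat_map n') [x1, x2]) \<and> x3 \<noteq> 0 \<and> n' dvd x3) \<or>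
        (\<not> p' dvd x1 \<and> p' dvd x2 \<and> p' dvd x3 \<and>
         D_extremal n' (S n') (map (nat_map n') [x2, x3]) \<and>
         \<not> D_extremal n' (U n') (map (nat_map n') [x2, x3]))))"
proof -
  have p': "p' \<in> prime_factors n" using assms(1,4,5) by (simp add: in_prime_factors_iff)
  then have "card (prime_factors n - {p'}) = 2" using assms(6) by simp
  then obtain q r where qr: "prime_factors n - {p'} = {q, r}" "q \<noteq> r" by (meson card_2_iff)
  then have factors: "prime_factors n = {p', q, r}" "p' \<noteq> q" "p' \<noteq> r" using p' by auto
  then have "prime q" "q dvd n" "prime r" "r dvd n"
    by (metis in_prime_factors_iff insertCI)+
  then interpret three_primes p' q r
    using assms(3-5) factors qr(2) by unfold_locales auto
  \<comment> \<open>Squarefreeness makes every multiplicity 1, so \<open>n\<close> is the product of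
    its three prime factors.\<close>
  have "n = (\<Prod>p\<in>prime_factors n. p ^ multiplicity p n)"
    using prod_prime_factors[of n] assms(1) by simp
  also have "\<dots> = \<Prod>{p', q, r}"
  proof (subst factors(1), rule prod.cong[OF refl])
    fix l assume "l \<in> {p', q, r}"
    then have "l \<in> prime_factors n" using factors by simp
    then show "l ^ multiplicity l n = l"
      using assms(1,2) squarefree_factorial_semiring'[of n] by simp
  qed
  finally have n: "n = p' * q * r" unfolding prod_pqr .
  have "n' = q * r" using assms(7) ge7 by (simp add: n mult.assoc)
  then show ?thesis using D_extremal_L_iff assms(8) unfolding n by simp
qed

end
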